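(* Let $M$ be a manifold and let $\overline{\mathcal H}$ and $\mathcal H$ be two (possibly nonlinear) connections on $TM$, with associated covariant derivatives $\overline\nabla$ and $\nabla$ and difference operator $\mathcal D=\overline\nabla-\nabla$. Then $\overline{\mathcal H}$ and $\mathcal H$ have the same geodesic quasispray if and only if $\mathcal D$ is alternating, i.e. vanishes on the diagonal of $TM\oplus TM$: $\mathcal D(v,v)=0$ for all $v\in TM$.
   Context: $M$ is a smooth, finite-dimensional, Hausdorff, paracompact, connected manifold; all objects are smooth. $\pi:TM\to M$ is the projection; $\pi_T:TTM\to TM$ is the usual tangent bundle projection and $\pi_*:TTM\to TM$ the tangent map of $\pi$. The vertical bundle is $\mathcal V=\ker\pi_*$. A connection is a smooth subbundle $\mathcal H$ of $\pi_T:TTM\to TM$ with $TTM=\mathcal H\oplus\mathcal V$. $H$ denotes the projection of $TTM$ onto $\mathcal H$ along $\mathcal V$, with $H_v:T_vTM\to\mathcal H_v$. $K:\mathcal V\to TM$ is the canonical map which on $\mathcal V_v=T_v(T_pM)$ is the canonical identification with $T_pM$. The covariant derivative associated to $\mathcal H$ is $\nabla_UV=K(V_*U-H_VV_*U)$ for vector fields $U,V$ on $M$, where $V_*$ is the tangent map of $V:M\to TM$; it is tensorial in $U$, in general nonlinear in $V$. The difference operator of two covariant derivatives is $\mathcal D(U,V)=\overline\nabla_UV-\nabla_UV$. Its value at $p$ depends only on $U_p$ and $V_p$, so $\mathcal D(u,v)\in T_pM$ is defined for $u,v\in T_pM$; it is linear in $u$ but in general nonlinear in $v$. The geodesic quasispray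 of a connection $\mathcal H$ is the vector field $S$ on $TM$ given by $S(v)=(\pi_*|_{\mathcal H_v})^{-1}(v)$, $v\in TM$. *)

theory Defs
  imports "HOL-Analysis.Analysis"
begin

section \<open>Smooth maps between vector spaces\<close>

text \<open>
  For open \<open>S\<close> and finite-dimensional \<open>'a\<close>, continuity of all directional derivatives of a
  differentiable map amounts to continuity of its derivative, so that \<open>Ck_on n S f\<close> is the usual
  notion of an n times continuously differentiable map.
\<close>

primrec Ck_on ::
    "nat \<Rightarrow> 'a set \<Rightarrow> ('a::real_normed_vector \<Rightarrow> 'b::real_normed_vector) \<Rightarrow> bool" where
  "Ck_on 0 S f \<longleftrightarrow> continuous_on S f"
| "Ck_on (Suc n) S f \<longleftrightarrow>
     (\<forall>x\<in>S. f differentiable (at x)) \<and> (\<forall>h. Ck_on n S (\<lambda>x. frechet_derivative f (at x) h))"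

definition smooth_on :: "'a set \<Rightarrow> ('a::real_normed_vector \<Rightarrow> 'b::real_normed_vector) \<Rightarrow> bool" where
  "smooth_on S f \<longleftrightarrow> (\<forall>n. Ck_on n S f)"


section \<open>Manifolds\<close>

text \<open>
  A chart is a pair of its domain and its coordinate map (whose values off the domain are
  irrelevant). A manifold is represented by an atlas, i.e. a set of charts, maximal or not: the
  points are the union of the chart domains, and the topology is the one for which the charts
  are homeomorphisms onto open sets.
\<close>

type_synonym ('m, 'e) chart = "'m set \<times> ('m \<Rightarrow> 'e)"

abbreviation cdom :: "('m, 'e) chart \<Rightarrow> 'm set" where "cdom \<equiv> fst"
abbreviation cmap :: "('m, 'e) chart \<Rightarrow> 'm \<Rightarrow> 'e" where "cmap \<equiv> snd"

definition cinv :: "('m, 'e) chart \<Rightarrow> 'e \<Rightarrow> 'm" where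
  "cinv c = inv_into (cdom c) (cmap c)"

definition points :: "('m, 'e) chart set \<Rightarrow> 'm set" where
  "points M = (\<Union>c\<in>M. cdom c)"

definition atlas_topology :: "('m, 'e::real_normed_vector) chart set \<Rightarrow> 'm topology" where
  "atlas_topology M = topology (\<lambda>W. W \<subseteq> points M \<and> (\<forall>c\<in>M. open (cmap c ` (cdom c \<inter> W))))"

definition smooth_atlas :: "('m, 'e::real_normed_vector) chart set \<Rightarrow> bool" where
  "smooth_atlas M \<longleftrightarrow>
     (\<forall>c\<in>M. inj_on (cmap c) (cdom c)) \<and>
     (\<forall>c\<in>M. \<forall>d\<in>M. open (cmap c ` (cdom c \<inter> cdom d)) \<and>
        smooth_on (cmap c ` (cdom c \<inter> cdom d)) (cmap d \<circ> cinv c))"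

definition paracompact_space :: "'m topology \<Rightarrow> bool" where
  "paracompact_space X \<longleftrightarrow>
     (\<forall>\<U>. (\<forall>U\<in>\<U>. openin X U) \<and> \<Union>\<U> = topspace X \<longrightarrow>
        (\<exists>\<V>. (\<forall>V\<in>\<V>. openin X V \<and> (\<exists>U\<in>\<U>. V \<subseteq> U)) \<and> \<Union>\<V> = topspace X \<and>
             locally_finite_in X \<V>))"

text \<open>
  The model space is a finite-dimensional type of class \<^class>\<open>real_inner\<close> rather than
  \<^class>\<open>euclidean_space\<close>, since the latter excludes dimension zero.
\<close>

definition smooth_manifold :: "('m, 'e::real_inner) chart set \<Rightarrow> bool" where
  "smooth_manifold M \<longleftrightarrow>
     (\<exists>B::'e set. finite B \<and> span B = UNIV) \<and>
     smooth_atlas M \<and>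
     Hausdorff_space (atlas_topology M) \<and>
     paracompact_space (atlas_topology M) \<and>
     connected_space (atlas_topology M)"

definition smooth_map ::
    "('m, 'e::real_normed_vector) chart set \<Rightarrow> ('n, 'f::real_normed_vector) chart set \<Rightarrow>
     ('m \<Rightarrow> 'n) \<Rightarrow> bool" where
  "smooth_map M N f \<longleftrightarrow>
     f ` points M \<subseteq> points N \<and>
     (\<forall>c\<in>M. \<forall>d\<in>N. open (cmap c ` (cdom c \<inter> f -` cdom d)) \<and>
        smooth_on (cmap c ` (cdom c \<inter> f -` cdom d)) (cmap d \<circ> f \<circ> cinv c))"

definition restrict_atlas :: "('m, 'e) chart set \<Rightarrow> 'm set \<Rightarrow> ('m, 'e) chart set" where
  "restrict_atlas M W = (\<lambda>c. (cdom c \<inter> W, cmap c)) ` M"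


section \<open>The tangent bundle\<close>

text \<open>
  A tangent vector consists of its base point \<open>p\<close> and the family of its coordinates with respect
  to all charts around \<open>p\<close>; these are related by the derivatives of the coordinate changes. The
  family is set to zero on everything that is not a chart around \<open>p\<close>.
\<close>

type_synonym ('m, 'e) tvec = "'m \<times> (('m, 'e) chart \<Rightarrow> 'e)"

definition tangent_space ::
    "('m, 'e::real_normed_vector) chart set \<Rightarrow> 'm \<Rightarrow> ('m, 'e) tvec set" where
  "tangent_space M p = {v. fst v = p \<and> p \<in> points M \<and>
     (\<forall>c\<in>M. \<forall>d\<in>M. p \<in> cdom c \<and> p \<in> cdom d \<longrightarrow>
        snd v d = frechet_derivative (cmap d \<circ> cinv c) (at (cmap c p)) (snd v c)) \<and>
     (\<forall>c. \<not> (c \<in> M \<and> p \<in> cdom c) \<longrightarrow> snd v c = 0)}"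

definition tangent_bundle :: "('m, 'e::real_normed_vector) chart set \<Rightarrow> ('m, 'e) tvec set" where
  "tangent_bundle M = (\<Union>p\<in>points M. tangent_space M p)"

text \<open>The vector space operations are meant for vectors with the same base point.\<close>

definition tv_zero :: "'m \<Rightarrow> ('m, 'e::real_vector) tvec" where
  "tv_zero p = (p, \<lambda>c. 0)"

definition tv_add :: "('m, 'e::real_vector) tvec \<Rightarrow> ('m, 'e) tvec \<Rightarrow> ('m, 'e) tvec" where
  "tv_add v w = (fst v, \<lambda>c. snd v c + snd w c)"

definition tv_diff :: "('m, 'e::real_vector) tvec \<Rightarrow> ('m, 'e) tvec \<Rightarrow> ('m, 'e) tvec" where
  "tv_diff v w = (fst v, \<lambda>c. snd v c - snd w c)"

definition tv_scale :: "real \<Rightarrow> ('m, 'e::real_vector) tvec \<Rightarrow> ('m, 'e) tvec" where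
  "tv_scale r v = (fst v, \<lambda>c. r *\<^sub>R snd v c)"

text \<open>
  The tangent bundle is again a manifold, so that \<open>tangent_atlas (tangent_atlas M)\<close> and
  \<open>tangent_bundle (tangent_atlas M)\<close> describe the iterated tangent bundle. The bundle
  projections \<open>TM \<rightarrow> M\<close> and \<open>TTM \<rightarrow> TM\<close> are both \<^term>\<open>fst\<close>.
\<close>

definition tangent_chart ::
    "('m, 'e::real_normed_vector) chart set \<Rightarrow> ('m, 'e) chart \<Rightarrow>
     (('m, 'e) tvec, 'e \<times> 'e) chart" where
  "tangent_chart M c = ({v \<in> tangent_bundle M. fst v \<in> cdom c}, \<lambda>v. (cmap c (fst v), snd v c))"

definition tangent_atlas ::
    "('m, 'e::real_normed_vector) chart set \<Rightarrow> (('m, 'e) tvec, 'e \<times> 'e) chart set" where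
  "tangent_atlas M = tangent_chart M ` M"

text \<open>For smooth \<open>f\<close>, the tangent map does not depend on the selected chart around the base point.\<close>

definition tangent_map ::
    "('m, 'e::real_normed_vector) chart set \<Rightarrow> ('n, 'f::real_normed_vector) chart set \<Rightarrow>
     ('m \<Rightarrow> 'n) \<Rightarrow> ('m, 'e) tvec \<Rightarrow> ('n, 'f) tvec" where
  "tangent_map M N f v =
     (let p = fst v; c = (SOME c. c \<in> M \<and> p \<in> cdom c) in
      (f p, \<lambda>d. if d \<in> N \<and> f p \<in> cdom d
                then frechet_derivative (cmap d \<circ> f \<circ> cinv c) (at (cmap c p)) (snd v c)
                else 0))"

definition velocity ::
    "('m, 'e::real_normed_vector) chart set \<Rightarrow> (real \<Rightarrow> 'm) \<Rightarrow> real \<Rightarrow> ('m, 'e) tvec" where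
  "velocity M \<gamma> t =
     (\<gamma> t, \<lambda>c. if c \<in> M \<and> \<gamma> t \<in> cdom c then vector_derivative (cmap c \<circ> \<gamma>) (at t) else 0)"

definition vector_field_on ::
    "('m, 'e::real_normed_vector) chart set \<Rightarrow> 'm set \<Rightarrow> ('m \<Rightarrow> ('m, 'e) tvec) \<Rightarrow> bool" where
  "vector_field_on M W X \<longleftrightarrow>
     smooth_map (restrict_atlas M W) (tangent_atlas M) X \<and> (\<forall>p\<in>W. fst (X p) = p)"

definition vector_field ::
    "('m, 'e::real_normed_vector) chart set \<Rightarrow> ('m \<Rightarrow> ('m, 'e) tvec) \<Rightarrow> bool" where
  "vector_field M X \<longleftrightarrow> vector_field_on M (points M) X"

definition lincomb ::
    "nat \<Rightarrow> (nat \<Rightarrow> real) \<Rightarrow> (nat \<Rightarrow> 'm \<Rightarrow> ('m, 'e::real_vector) tvec) \<Rightarrow> 'm \<Rightarrow> ('m, 'e) tvec" where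
  "lincomb k a X p = (p, \<lambda>c. \<Sum>i<k. a i *\<^sub>R snd (X i p) c)"

text \<open>A subbundle of the tangent bundle is one that has smooth local frames.\<close>

definition smooth_subbundle ::
    "('m, 'e::real_normed_vector) chart set \<Rightarrow> ('m, 'e) tvec set \<Rightarrow> bool" where
  "smooth_subbundle M E \<longleftrightarrow>
     E \<subseteq> tangent_bundle M \<and>
     (\<forall>p\<in>points M. \<exists>W k X. openin (atlas_topology M) W \<and> p \<in> W \<and>
        (\<forall>i<k. vector_field_on M W (X i)) \<and>
        (\<forall>q\<in>W. (\<forall>a. lincomb k a X q = tv_zero q \<longrightarrow> (\<forall>i<k. a i = 0)) \<and>
                E \<inter> tangent_space M q = range (\<lambda>a. lincomb k a X q)))"


section \<open>Connections\<close>

type_synonym ('m, 'e) ttvec = "(('m, 'e) tvec, 'e \<times> 'e) tvec"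

definition dproj ::
    "('m, 'e::real_normed_vector) chart set \<Rightarrow> ('m, 'e) ttvec \<Rightarrow> ('m, 'e) tvec" where
  "dproj M = tangent_map (tangent_atlas M) M fst"

definition vertical ::
    "('m, 'e::real_normed_vector) chart set \<Rightarrow> ('m, 'e) ttvec set" where
  "vertical M = {\<xi> \<in> tangent_bundle (tangent_atlas M). dproj M \<xi> = tv_zero (fst (fst \<xi>))}"

definition fibre :: "('m, 'e) tvec set \<Rightarrow> 'm \<Rightarrow> ('m, 'e) tvec set" where
  "fibre E p = {v \<in> E. fst v = p}"

definition connection ::
    "('m, 'e::real_normed_vector) chart set \<Rightarrow> ('m, 'e) ttvec set \<Rightarrow> bool" where
  "connection M H \<longleftrightarrow>
     smooth_subbundle (tangent_atlas M) H \<and>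
     (\<forall>v\<in>tangent_bundle M.
        fibre H v \<inter> fibre (vertical M) v = {tv_zero v} \<and>
        (\<forall>\<xi>\<in>tangent_space (tangent_atlas M) v.
           \<exists>h\<in>fibre H v. \<exists>w\<in>fibre (vertical M) v. \<xi> = tv_add h w))"

definition hproj ::
    "('m, 'e::real_normed_vector) chart set \<Rightarrow> ('m, 'e) ttvec set \<Rightarrow>
     ('m, 'e) ttvec \<Rightarrow> ('m, 'e) ttvec" where
  "hproj M H \<xi> =
     (THE h. h \<in> fibre H (fst \<xi>) \<and> (\<exists>w\<in>fibre (vertical M) (fst \<xi>). \<xi> = tv_add h w))"

text \<open>
  The canonical identification of a vector space with its tangent space at \<open>v\<close> sends \<open>w\<close> to the
  velocity of the line \<open>t \<mapsto> v + t w\<close> at \<open>t = 0\<close>.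
\<close>

definition vlift ::
    "('m, 'e::real_normed_vector) chart set \<Rightarrow> ('m, 'e) tvec \<Rightarrow> ('m, 'e) tvec \<Rightarrow>
     ('m, 'e) ttvec" where
  "vlift M v w = velocity (tangent_atlas M) (\<lambda>t. tv_add v (tv_scale t w)) 0"

definition K_map ::
    "('m, 'e::real_normed_vector) chart set \<Rightarrow> ('m, 'e) ttvec \<Rightarrow> ('m, 'e) tvec" where
  "K_map M \<xi> = (THE w. w \<in> tangent_space M (fst (fst \<xi>)) \<and> vlift M (fst \<xi>) w = \<xi>)"

definition covariant_derivative ::
    "('m, 'e::real_normed_vector) chart set \<Rightarrow> ('m, 'e) ttvec set \<Rightarrow>
     ('m \<Rightarrow> ('m, 'e) tvec) \<Rightarrow> ('m \<Rightarrow> ('m, 'e) tvec) \<Rightarrow> 'm \<Rightarrow> ('m, 'e) tvec" where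
  "covariant_derivative M H U V p =
     (let \<xi> = tangent_map M (tangent_atlas M) V (U p)
      in K_map M (tv_diff \<xi> (hproj M H \<xi>)))"

definition difference_operator ::
    "('m, 'e::real_normed_vector) chart set \<Rightarrow> ('m, 'e) ttvec set \<Rightarrow> ('m, 'e) ttvec set \<Rightarrow>
     ('m \<Rightarrow> ('m, 'e) tvec) \<Rightarrow> ('m \<Rightarrow> ('m, 'e) tvec) \<Rightarrow> 'm \<Rightarrow> ('m, 'e) tvec" where
  "difference_operator M H' H U V p =
     tv_diff (covariant_derivative M H' U V p) (covariant_derivative M H U V p)"

text \<open>
  The value of the difference operator on two tangent vectors at the same point is the common
  value at that point for all (global) vector fields extending them.
\<close>

definition difference_at ::
    "('m, 'e::real_normed_vector) chart set \<Rightarrow> ('m, 'e) ttvec set \<Rightarrow> ('m, 'e) ttvec set \<Rightarrow>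
     ('m, 'e) tvec \<Rightarrow> ('m, 'e) tvec \<Rightarrow> ('m, 'e) tvec" where
  "difference_at M H' H u v =
     (THE w. \<exists>U V. vector_field M U \<and> vector_field M V \<and> U (fst u) = u \<and> V (fst u) = v \<and>
                   w = difference_operator M H' H U V (fst u))"

definition quasispray ::
    "('m, 'e::real_normed_vector) chart set \<Rightarrow> ('m, 'e) ttvec set \<Rightarrow>
     ('m, 'e) tvec \<Rightarrow> ('m, 'e) ttvec" where
  "quasispray M H v = inv_into (fibre H v) (dproj M) v"

end

theory Submission
  imports Defs
begin

text \<open>
  Let \<open>V\<close> be a vector field with \<open>V p = v\<close> and let \<open>\<xi> = V\<^sub>* v\<close>. Since \<open>V\<close> is a section, \<open>\<pi>\<^sub>* \<xi> = v\<close>, so the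
  horizontal part of \<open>\<xi>\<close>, being the unique horizontal vector at \<open>v\<close> over \<open>v\<close>, is the quasispray \<open>S v\<close>.
  Hence \<open>\<D>(v, v) = K(\<xi> - S' v) - K(\<xi> - S v)\<close>, which for linear \<open>K\<close> is \<open>K(S v - S' v)\<close> and vanishes
  exactly if \<open>S' v = S v\<close>. That \<open>\<D>(v, v)\<close> has any value at all requires a global field extending \<open>v\<close>:
  in a chart, a constant field is multiplied by a bump function, and the Hausdorff property makes
  the compact support closed, so that the product extends smoothly by zero.
\<close>

section \<open>Calculus of smooth maps\<close>

text \<open>Everything on \<open>TTM\<close> is reduced to coordinates. In a tangent chart a vector
  of \<open>TTM\<close> at \<open>v\<close> is a pair; \<open>dproj\<close> reads its first entry
  and, on vertical vectors, \<open>K_map\<close> reads its second. Both values of the quasispray at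
  \<open>v\<close> lie over \<open>v\<close>, so their first entries agree, and the diagonal value
  of the difference operator is exactly the difference of their second entries. The contribution of
  \<open>V\<close> to the covariant derivative is the same for both connections and cancels; this is
  why the definite description in \<open>difference_at\<close> has one value for all extensions.
  Extensions serve a second purpose: the differential of such a field applied to \<open>v\<close> is
  a vector of \<open>TTM\<close> over \<open>v\<close>, so \<open>inv_into\<close> in
  \<open>quasispray\<close> has a genuine preimage to return. Applying the general facts on tangent
  spaces to \<open>TTM\<close> requires the tangent charts to form a smooth atlas. This and the
  chain rule meet the same obstacle: \<open>Ck_on\<close> differentiates in a fixed direction,
  whereas the directions that arise vary with the point. Expansion in an orthogonal frame restores
  fixed directions.\<close>

lemma Ck_on_has_derivative:
  "Ck_on (Suc n) S f \<Longrightarrow> x \<in> S \<Longrightarrow> (f has_derivative frechet_derivative f (at x)) (at x)"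
  by (simp add: frechet_derivative_works)

lemma Ck_on_Suc_imp: "Ck_on (Suc n) S f \<Longrightarrow> Ck_on n S f"
proof (induction n arbitrary: f)
  case 0
  then show ?case
    by (auto intro!: continuous_at_imp_continuous_on differentiable_imp_continuous_within)
next
  case (Suc n)
  have "Ck_on n S (\<lambda>x. frechet_derivative f (at x) h)" for h
    by (rule Suc.IH) (use Suc.prems in simp)
  with Suc.prems show ?case by simp
qed

text \<open>Since \<open>S\<close> is open, maps that agree on \<open>S\<close> agree near each of
  its points and have the same derivative there; the induction then passes to the directional
  derivatives.\<close>

lemma Ck_on_cong:
  fixes f g :: "'a::real_normed_vector \<Rightarrow> 'b::real_normed_vector"
  assumes S: "open S" and "\<And>x. x \<in> S \<Longrightarrow> f x = g x" "Ck_on n S f"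
  shows "Ck_on n S g"
  using assms(2,3)
proof (induction n arbitrary: f g)
  case 0
  then show ?case by (simp cong: continuous_on_cong)
next
  case (Suc n)
  have d: "(g has_derivative frechet_derivative f (at x)) (at x)" if "x \<in> S" for x
    using has_derivative_transform_within_open[OF Ck_on_has_derivative[OF Suc.prems(2) that] S that]
      Suc.prems(1) by simp
  have eq: "frechet_derivative f (at x) h = frechet_derivative g (at x) h" if "x \<in> S" for x h
    using frechet_derivative_at[OF d[OF that]] by (rule fun_cong)
  have "Ck_on n S (\<lambda>x. frechet_derivative g (at x) h)" for h
    using Suc.prems(2) by (intro Suc.IH[OF eq]) simp_all
  with d show ?case by (auto simp: differentiable_def)
qed

text \<open>Allows a derivative to be given by an explicit formula, so that each closure property
  below reduces to the induction hypothesis on the terms of that formula.\<close>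

lemma Ck_on_SucI:
  fixes f :: "'a::real_normed_vector \<Rightarrow> 'b::real_normed_vector"
  assumes "open S" "\<And>x. x \<in> S \<Longrightarrow> (f has_derivative f' x) (at x)" "\<And>h. Ck_on n S (\<lambda>x. f' x h)"
  shows "Ck_on (Suc n) S f"
proof -
  have eq: "f' x h = frechet_derivative f (at x) h" if "x \<in> S" for x h
    using frechet_derivative_at[OF assms(2)[OF that]] by (rule fun_cong)
  have "Ck_on n S (\<lambda>x. frechet_derivative f (at x) h)" for h
    by (rule Ck_on_cong[OF assms(1) eq assms(3)[of h]])
  with assms(2) show ?thesis by (auto simp: differentiable_def)
qed

lemma Ck_on_subset: "Ck_on n S f \<Longrightarrow> T \<subseteq> S \<Longrightarrow> Ck_on n T f"
  by (induction n arbitrary: f) (auto intro: continuous_on_subset)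

text \<open>Serves to glue: the extension of a tangent vector to a field is given by different
  formulas on different open sets.\<close>

lemma Ck_on_local:
  assumes "\<And>x. x \<in> S \<Longrightarrow> \<exists>T. open T \<and> x \<in> T \<and> Ck_on n T f"
  shows "Ck_on n S f"
  using assms
proof (induction n arbitrary: f)
  case 0
  have "isCont f x" if x: "x \<in> S" for x
    using 0[OF x] x continuous_on_eq_continuous_at by auto
  then show ?case
    by (simp add: continuous_at_imp_continuous_on)
next
  case (Suc n)
  have "Ck_on n S (\<lambda>x. frechet_derivative f (at x) h)" for h
  proof (rule Suc.IH)
    fix x assume "x \<in> S"
    from Suc.prems[OF this] show "\<exists>T. open T \<and> x \<in> T \<and> Ck_on n T (\<lambda>x. frechet_derivative f (at x) h)"
      by auto
  qed
  moreover have "f differentiable at x" if "x \<in> S" for x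
    using Suc.prems[OF that] by auto
  ultimately show ?case by simp
qed

section \<open>Closure properties of \<open>Ck_on\<close>\<close>

lemma Ck_on_const: "open S \<Longrightarrow> Ck_on n S (\<lambda>x. c)"
proof (induction n arbitrary: c)
  case (Suc n)
  then show ?case by (intro Ck_on_SucI[OF Suc.prems has_derivative_const]) blast
qed simp

lemma Ck_on_bounded_linear:
  assumes "open S" "bounded_linear L" "Ck_on n S f"
  shows "Ck_on n S (\<lambda>x. L (f x))"
  using assms(3)
proof (induction n arbitrary: f)
  case 0
  then show ?case
    using assms(2) by (simp add: bounded_linear.continuous_on)
next
  case (Suc n)
  have "((\<lambda>x. L (f x)) has_derivative (\<lambda>h. L (frechet_derivative f (at x) h))) (at x)"
    if "x \<in> S" for x
    using bounded_linear.has_derivative[OF assms(2) Ck_on_has_derivative[OF Suc.prems that]] .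
  then show ?case
    using Suc assms by (intro Ck_on_SucI) auto
qed

lemma Ck_on_id: "open S \<Longrightarrow> Ck_on n S (\<lambda>x. x)"
proof (induction n)
  case (Suc n)
  then show ?case by (intro Ck_on_SucI[OF Suc.prems has_derivative_ident] Ck_on_const)
qed simp

lemma Ck_on_add:
  assumes "open S" "Ck_on n S f" "Ck_on n S g"
  shows "Ck_on n S (\<lambda>x. f x + g x)"
  using assms(2,3)
proof (induction n arbitrary: f g)
  case 0
  then show ?case by (simp add: continuous_on_add)
next
  case (Suc n)
  have "((\<lambda>x. f x + g x) has_derivative
      (\<lambda>h. frechet_derivative f (at x) h + frechet_derivative g (at x) h)) (at x)" if "x \<in> S" for x
    using has_derivative_add Ck_on_has_derivative Suc.prems that by blast
  then show ?case
    using Suc assms(1) by (intro Ck_on_SucI) auto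
qed

lemma Ck_on_sum:
  assumes "open S" "\<And>i. i \<in> I \<Longrightarrow> Ck_on n S (f i)"
  shows "Ck_on n S (\<lambda>x. \<Sum>i\<in>I. f i x)"
  using assms(2)
  by (induction I rule: infinite_finite_induct) (auto intro!: Ck_on_const Ck_on_add assms(1))

lemma Ck_on_bilinear:
  assumes "open S" "bounded_bilinear bl" "Ck_on n S f" "Ck_on n S g"
  shows "Ck_on n S (\<lambda>x. bl (f x) (g x))"
  using assms(3,4)
proof (induction n arbitrary: f g)
  case 0
  then show ?case by (simp add: bounded_bilinear.continuous_on[OF assms(2)])
next
  case (Suc n)
  have d: "((\<lambda>x. bl (f x) (g x)) has_derivative
      (\<lambda>h. bl (f x) (frechet_derivative g (at x) h) + bl (frechet_derivative f (at x) h) (g x))) (at x)"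
    if "x \<in> S" for x
    using bounded_bilinear.FDERIV[OF assms(2) Ck_on_has_derivative[OF Suc.prems(1) that]
        Ck_on_has_derivative[OF Suc.prems(2) that]] .
  have "Ck_on n S f" "Ck_on n S g"
    using Suc.prems by (blast intro: Ck_on_Suc_imp)+
  moreover have "Ck_on n S (\<lambda>x. frechet_derivative f (at x) h)"
      "Ck_on n S (\<lambda>x. frechet_derivative g (at x) h)" for h
    using Suc.prems by simp_all
  ultimately show ?case
    by (intro Ck_on_SucI[OF assms(1) d] Ck_on_add[OF assms(1)] Suc.IH)
qed

lemma Ck_on_Pair:
  assumes "open S" "Ck_on n S f" "Ck_on n S g"
  shows "Ck_on n S (\<lambda>x. (f x, g x))"
proof -
  \<comment> \<open>Each summand is a bounded linear image of \<open>f\<close> or of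
    \<open>g\<close>.\<close>
  have "Ck_on n S (\<lambda>x. (f x, 0) + (0, g x))"
    by (intro Ck_on_add assms Ck_on_bounded_linear[OF assms(1) bounded_linear_Pair])
      (auto intro: bounded_linear_intros)
  then show ?thesis by simp
qed

text \<open>
  A frame may contain \<open>0\<close>, whose coefficient is then \<open>x / 0 = 0\<close>. It replaces \<^const>\<open>Basis\<close>, which
  the class \<^class>\<open>real_inner\<close> does not provide.
\<close>

definition orthogonal_frame :: "'a::real_inner set \<Rightarrow> bool" where
  "orthogonal_frame B \<longleftrightarrow> finite B \<and> (\<forall>x. (\<Sum>b\<in>B. (x \<bullet> b / (b \<bullet> b)) *\<^sub>R b) = x)"

text \<open>Gram-Schmidt orthogonalisation provides an orthogonal spanning set. The defect
  \<open>y\<close> of the expansion of \<open>x\<close> is orthogonal to every member of it, hence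
  to the whole space, hence to itself, and so is zero.\<close>

lemma orthogonal_frame_exists:
  assumes "finite B" "span B = (UNIV :: 'a::real_inner set)"
  shows "\<exists>C::'a set. orthogonal_frame C"
proof -
  obtain C :: "'a set" where C: "finite C" "span C = UNIV" "pairwise orthogonal C"
    using basis_orthogonal[OF assms(1)] assms(2) by metis
  have "(\<Sum>b\<in>C. (x \<bullet> b / (b \<bullet> b)) *\<^sub>R b) = x" for x
  proof -
    define y where "y = x - (\<Sum>b\<in>C. (x \<bullet> b / (b \<bullet> b)) *\<^sub>R b)"
    have "orthogonal y c" if "c \<in> C" for c
    proof -
      have "(\<Sum>b\<in>C. (x \<bullet> b / (b \<bullet> b)) *\<^sub>R b) \<bullet> c = (\<Sum>b\<in>C. if b = c then x \<bullet> c else 0)"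
        unfolding inner_sum_left using C(3) that
        by (intro sum.cong) (auto simp: pairwise_def orthogonal_def)
      then show ?thesis
        using C(1) that by (simp add: y_def orthogonal_def inner_diff_left)
    qed
    then have "orthogonal y y"
      using orthogonal_to_span C(2) by blast
    then show ?thesis by (simp add: y_def orthogonal_def)
  qed
  with C(1) show ?thesis by (auto simp: orthogonal_frame_def)
qed

lemma orthogonal_frame_real: "orthogonal_frame {1::real}"
  by (simp add: orthogonal_frame_def)

lemma linear_orthogonal_frame:
  assumes "orthogonal_frame B" "linear L"
  shows "L x = (\<Sum>b\<in>B. (x \<bullet> b / (b \<bullet> b)) *\<^sub>R L b)"
proof -
  have "L x = L (\<Sum>b\<in>B. (x \<bullet> b / (b \<bullet> b)) *\<^sub>R b)"
    using assms(1) by (simp add: orthogonal_frame_def)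
  then show ?thesis
    by (simp add: linear_sum[OF assms(2)] linear_cmul[OF assms(2)])
qed

text \<open>By the chain rule the derivative is \<open>g' (f x) (f' x h)\<close>, where
  \<open>g\<close> is differentiated in a direction that moves with \<open>x\<close>. Expanding
  \<open>f' x h\<close> in the frame gives a finite sum of scalar functions times
  \<open>g' (f x) b\<close> with \<open>b\<close> fixed, and the induction hypothesis applies to the
  latter.\<close>

lemma Ck_on_compose:
  fixes f :: "'a::real_normed_vector \<Rightarrow> 'b::real_inner"
    and g :: "'b \<Rightarrow> 'c::real_normed_vector"
  assumes "orthogonal_frame (B :: 'b set)" "open S" "f ` S \<subseteq> T" "Ck_on n S f" "Ck_on n T g"
  shows "Ck_on n S (\<lambda>x. g (f x))"
  using assms(4,5)
proof (induction n arbitrary: g)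
  case 0
  then show ?case
    using assms(3) by (simp add: continuous_on_compose2)
next
  case (Suc n)
  define f' where "f' x = frechet_derivative f (at x)" for x
  define g' where "g' y = frechet_derivative g (at y)" for y
  have f': "(f has_derivative f' x) (at x)" if "x \<in> S" for x
    using Ck_on_has_derivative[OF Suc.prems(1) that] by (simp add: f'_def)
  have g': "(g has_derivative g' y) (at y)" if "y \<in> T" for y
    using Ck_on_has_derivative[OF Suc.prems(2) that] by (simp add: g'_def)
  show ?case
  proof (rule Ck_on_SucI[OF assms(2)])
    fix x assume x: "x \<in> S"
    have fx: "f x \<in> T" using assms(3) x by blast
    have "(\<lambda>h. g' (f x) (f' x h)) = (\<lambda>h. \<Sum>b\<in>B. (f' x h \<bullet> b / (b \<bullet> b)) *\<^sub>R g' (f x) b)"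
      by (rule ext, rule linear_orthogonal_frame[OF assms(1) has_derivative_linear[OF g'[OF fx]]])
    with has_derivative_compose[OF f'[OF x] g'[OF fx]] show "((\<lambda>x. g (f x)) has_derivative
        (\<lambda>h. \<Sum>b\<in>B. (f' x h \<bullet> b / (b \<bullet> b)) *\<^sub>R g' (f x) b)) (at x)"
      by simp
  next
    fix h
    have 1: "Ck_on n S (\<lambda>x. f' x h \<bullet> b / (b \<bullet> b))" for b
    proof (rule Ck_on_bounded_linear[OF assms(2), where L = "\<lambda>y. y \<bullet> b / (b \<bullet> b)"])
      show "bounded_linear (\<lambda>y. y \<bullet> b / (b \<bullet> b))"
        using bounded_linear_compose[OF bounded_linear_divide bounded_linear_inner_left] .
      show "Ck_on n S (\<lambda>x. f' x h)" using Suc.prems(1) by (simp add: f'_def)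
    qed
    have 2: "Ck_on n S (\<lambda>x. g' (f x) b)" for b
      by (rule Suc.IH[OF Ck_on_Suc_imp[OF Suc.prems(1)]]) (use Suc.prems(2) in \<open>simp add: g'_def\<close>)
    show "Ck_on n S (\<lambda>x. \<Sum>b\<in>B. (f' x h \<bullet> b / (b \<bullet> b)) *\<^sub>R g' (f x) b)"
      by (intro Ck_on_sum Ck_on_bilinear[OF assms(2) bounded_bilinear_scaleR] assms(2) 1 2)
  qed
qed


section \<open>Bump functions\<close>

lemma poly_div_exp_tendsto_0: "((\<lambda>x. poly p x / exp x) \<longlongrightarrow> (0::real)) at_top"
proof -
  have "((\<lambda>x. \<Sum>i\<le>degree p. coeff p i * (x ^ i / exp x)) \<longlongrightarrow> (\<Sum>i\<le>degree p. coeff p i * 0)) at_top"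
    by (intro tendsto_intros tendsto_power_div_exp_0)
  then show ?thesis by (simp add: poly_altdef sum_divide_distrib)
qed

text \<open>The class of these functions is closed under differentiation.\<close>

definition flat_exp :: "real poly \<Rightarrow> real \<Rightarrow> real" where
  "flat_exp p t = (if t > 0 then poly p (1 / t) / exp (1 / t) else 0)"

text \<open>For positive \<open>t\<close>, differentiating
  \<open>poly p (1 / t) / exp (1 / t)\<close> replaces \<open>p\<close> by
  \<open>p - pderiv p\<close> and produces a factor \<open>1 / t^2\<close>, which the polynomial
  \<open>[:0, 0, 1:]\<close> absorbs. At zero the right difference quotient is again a polynomial in
  \<open>1 / h\<close> divided by \<open>exp (1 / h)\<close>, so it tends to zero.\<close>

lemma flat_exp_has_derivative:
  "(flat_exp p has_field_derivative flat_exp ([:0, 0, 1:] * (p - pderiv p)) t) (at t)"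
proof -
  let ?q = "[:0, 0, 1:] * (p - pderiv p)"
  consider "t > 0" | "t < 0" | "t = 0" by linarith
  then show ?thesis
  proof cases
    case 1
    have "((\<lambda>t. poly p (1 / t) / exp (1 / t)) has_field_derivative flat_exp ?q t) (at t)"
      unfolding flat_exp_def using 1
      by (auto intro!: derivative_eq_intros DERIV_chain2[OF poly_DERIV] simp: field_simps power2_eq_square)
    then show ?thesis
      by (rule has_field_derivative_transform_within_open[where S = "{0<..}"])
        (use 1 in \<open>auto simp: flat_exp_def\<close>)
  next
    case 2
    have "((\<lambda>t. 0) has_field_derivative flat_exp ?q t) (at t)"
      using 2 by (simp add: flat_exp_def)
    then show ?thesis
      by (rule has_field_derivative_transform_within_open[where S = "{..<0}"])
        (use 2 in \<open>auto simp: flat_exp_def\<close>)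
  next
    case 3
    have "((\<lambda>h. poly ([:0, 1:] * p) (inverse h) / exp (inverse h)) \<longlongrightarrow> 0) (at_right 0)"
      by (rule filterlim_compose[OF poly_div_exp_tendsto_0 filterlim_inverse_at_top_right])
    then have "((\<lambda>h. flat_exp p h / h) \<longlongrightarrow> 0) (at_right 0)"
      by (rule Lim_transform_eventually)
        (auto simp: eventually_at_right_less flat_exp_def field_simps intro: eventually_at_rightI[of 0 1])
    moreover have "((\<lambda>h. flat_exp p h / h) \<longlongrightarrow> 0) (at_left 0)"
      by (rule Lim_transform_eventually[OF tendsto_const])
        (auto simp: flat_exp_def intro: eventually_at_leftI[of "-1" 0])
    ultimately have "((\<lambda>h. flat_exp p h / h) \<longlongrightarrow> 0) (at 0)"
      by (simp add: filterlim_split_at)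
    then show ?thesis
      using 3 by (simp add: DERIV_def flat_exp_def)
  qed
qed

lemma Ck_on_flat_exp: "Ck_on n UNIV (flat_exp p)"
proof (induction n arbitrary: p)
  case 0
  then show ?case
    by (auto intro!: continuous_at_imp_continuous_on DERIV_isCont flat_exp_has_derivative)
next
  case (Suc n)
  show ?case
  proof (rule Ck_on_SucI)
    fix x
    show "(flat_exp p has_derivative (\<lambda>h. flat_exp ([:0, 0, 1:] * (p - pderiv p)) x * h)) (at x)"
      using flat_exp_has_derivative has_field_derivative_def by blast
  next
    fix h :: real
    show "Ck_on n UNIV (\<lambda>x. flat_exp ([:0, 0, 1:] * (p - pderiv p)) x * h)"
      by (intro Ck_on_bounded_linear[OF open_UNIV bounded_linear_mult_left] Suc)
  qed simp
qed

lemma smooth_bump_exists: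
  fixes y :: "'a::real_inner"
  assumes "r > 0"
  obtains \<beta> :: "'a \<Rightarrow> real"
    where "\<beta> y = 1" "\<And>x. x \<notin> cball y r \<Longrightarrow> \<beta> x = 0" "\<And>n. Ck_on n UNIV \<beta>"
proof -
  \<comment> \<open>The squared distance, unlike the norm, is smooth at \<open>y\<close>. The factor
    \<open>exp (1 / r\<^sup>2)\<close> cancels the value \<open>1 / exp (1 / r\<^sup>2)\<close> that
    \<open>flat_exp 1\<close> takes at \<open>r\<^sup>2\<close>, so that
    \<open>\<beta> y = 1\<close>.\<close>
  define \<beta> where "\<beta> x = flat_exp 1 (r\<^sup>2 - (x - y) \<bullet> (x - y)) * exp (1 / r\<^sup>2)" for x
  have 1: "\<beta> y = 1" using assms by (simp add: \<beta>_def flat_exp_def)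
  have 2: "\<beta> x = 0" if "x \<notin> cball y r" for x
  proof -
    have "r\<^sup>2 < (norm (x - y))\<^sup>2"
      using that assms by (intro power_strict_mono) (auto simp: dist_norm norm_minus_commute)
    then show ?thesis by (simp add: \<beta>_def flat_exp_def power2_norm_eq_inner)
  qed
  have 3: "Ck_on n UNIV \<beta>" for n
  proof -
    have 1: "Ck_on n UNIV (\<lambda>x. x + (- y))"
      by (intro Ck_on_add Ck_on_id Ck_on_const open_UNIV)
    have 2: "Ck_on n UNIV (\<lambda>x. (- 1) * ((x + (- y)) \<bullet> (x + (- y))))"
      by (intro Ck_on_bounded_linear[OF open_UNIV bounded_linear_mult_right]
          Ck_on_bilinear[OF open_UNIV bounded_bilinear_inner] 1)
    have "Ck_on n UNIV (\<lambda>x. r\<^sup>2 + (- 1) * ((x + (- y)) \<bullet> (x + (- y))))"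
      by (intro Ck_on_add 2 Ck_on_const open_UNIV)
    then have "Ck_on n UNIV (\<lambda>x. flat_exp 1 (r\<^sup>2 + (- 1) * ((x + (- y)) \<bullet> (x + (- y)))))"
      by (intro Ck_on_compose[OF orthogonal_frame_real open_UNIV _ _ Ck_on_flat_exp]) auto
    then have "Ck_on n UNIV (\<lambda>x. flat_exp 1 (r\<^sup>2 + (- 1) * ((x + (- y)) \<bullet> (x + (- y)))) * exp (1 / r\<^sup>2))"
      by (intro Ck_on_bounded_linear[OF open_UNIV bounded_linear_mult_left])
    then show ?thesis by (simp add: \<beta>_def[abs_def])
  qed
  from 1 2 3 show thesis by (rule that)
qed

text \<open>The ball is a closed subset of a parallelepiped spanned by the frame, and the latter is
  built from intervals by continuous images of products, one frame vector at a time.\<close>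

lemma compact_cball_frame:
  fixes y :: "'a::real_inner"
  assumes "orthogonal_frame (B :: 'a set)"
  shows "compact (cball y r)"
proof -
  define R where "R = norm y + \<bar>r\<bar>"
  have fin: "finite B" using assms by (simp add: orthogonal_frame_def)
  \<comment> \<open>By Cauchy-Schwarz the coefficient \<open>x \<bullet> b / (b \<bullet> b)\<close>
    is bounded by \<open>norm x / norm b\<close>. For \<open>b = 0\<close> both the bound and the
    coefficient are zero by the convention on division.\<close>
  define Q where "Q C = {(\<Sum>b\<in>C. t b *\<^sub>R b) |t. \<forall>b\<in>C. \<bar>t b\<bar> \<le> R / norm b}" for C :: "'a set"
  have "compact (Q C)" if "finite C" for C
    using that
  proof induction
    case empty
    then show ?case by (simp add: Q_def)
  next
    case (insert c C)
    let ?F = "\<lambda>(s::real, x). s *\<^sub>R c + x"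
    have "Q (insert c C) = ?F ` ({- (R / norm c)..R / norm c} \<times> Q C)"
    proof (intro subset_antisym subsetI)
      fix x assume "x \<in> Q (insert c C)"
      then obtain t where t: "x = (\<Sum>b\<in>insert c C. t b *\<^sub>R b)" "\<forall>b\<in>insert c C. \<bar>t b\<bar> \<le> R / norm b"
        by (auto simp: Q_def)
      have "x = ?F (t c, \<Sum>b\<in>C. t b *\<^sub>R b)"
        using insert by (simp add: t(1))
      moreover have "(t c, \<Sum>b\<in>C. t b *\<^sub>R b) \<in> {- (R / norm c)..R / norm c} \<times> Q C"
        using t(2) by (auto simp: Q_def abs_le_iff minus_le_iff)
      ultimately show "x \<in> ?F ` ({- (R / norm c)..R / norm c} \<times> Q C)" by blast
    next
      fix x assume "x \<in> ?F ` ({- (R / norm c)..R / norm c} \<times> Q C)"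
      then obtain s t where t: "x = s *\<^sub>R c + (\<Sum>b\<in>C. t b *\<^sub>R b)" "\<bar>s\<bar> \<le> R / norm c"
          "\<forall>b\<in>C. \<bar>t b\<bar> \<le> R / norm b"
        by (auto simp: Q_def abs_le_iff minus_le_iff)
      have "(\<Sum>b\<in>C. (t(c := s)) b *\<^sub>R b) = (\<Sum>b\<in>C. t b *\<^sub>R b)"
        using insert by (intro sum.cong) auto
      then have "x = (\<Sum>b\<in>insert c C. (t(c := s)) b *\<^sub>R b)"
        using insert by (simp add: t(1) del: fun_upd_apply) simp
      moreover have "\<forall>b\<in>insert c C. \<bar>(t(c := s)) b\<bar> \<le> R / norm b" using t by auto
      ultimately show "x \<in> Q (insert c C)" unfolding Q_def by blast
    qed
    moreover have "compact (?F ` ({- (R / norm c)..R / norm c} \<times> Q C))"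
      using insert
      by (intro compact_continuous_image compact_Times)
        (auto simp: case_prod_unfold intro!: continuous_intros)
    ultimately show ?case by simp
  qed
  then have "compact (Q B)" using fin by blast
  moreover have "cball y r \<subseteq> Q B"
  proof
    fix x assume "x \<in> cball y r"
    then have x: "norm x \<le> R"
      unfolding R_def by (smt (verit) mem_cball dist_norm norm_triangle_ineq2 norm_minus_commute)
    have "\<bar>x \<bullet> b / (b \<bullet> b)\<bar> \<le> R / norm b" for b
    proof (cases "b = 0")
      case False
      have "\<bar>x \<bullet> b\<bar> \<le> R * norm b"
        using Cauchy_Schwarz_ineq2[of x b] x mult_right_mono[OF x norm_ge_zero[of b]] by linarith
      then show ?thesis
        using False by (simp add: divide_simps dot_square_norm power2_eq_square)
    qed simp
    moreover have "x = (\<Sum>b\<in>B. (x \<bullet> b / (b \<bullet> b)) *\<^sub>R b)"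
      using assms by (simp add: orthogonal_frame_def)
    ultimately show "x \<in> Q B"
      unfolding Q_def by (intro CollectI exI[of _ "\<lambda>b. x \<bullet> b / (b \<bullet> b)"] conjI ballI)
  qed
  ultimately show ?thesis
    by (metis closed_cball compact_Int_closed inf.absorb_iff2)
qed

section \<open>Atlases and tangent spaces\<close>

definition jac :: "('m, 'e::real_normed_vector) chart \<Rightarrow> ('m, 'e) chart \<Rightarrow> 'm \<Rightarrow> 'e \<Rightarrow> 'e" where
  "jac c d p = frechet_derivative (cmap d \<circ> cinv c) (at (cmap c p))"

text \<open>The inverse of the coordinate isomorphism \<open>snd v c\<close> from the tangent space
  at \<open>p\<close> to the model space.\<close>

definition tv_of ::
    "('m, 'e::real_normed_vector) chart set \<Rightarrow> ('m, 'e) chart \<Rightarrow> 'm \<Rightarrow> 'e \<Rightarrow> ('m, 'e) tvec" where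
  "tv_of A c p a = (p, \<lambda>d. if d \<in> A \<and> p \<in> cdom d then jac c d p a else 0)"

lemma smooth_on_has_derivative:
  "smooth_on S f \<Longrightarrow> x \<in> S \<Longrightarrow> (f has_derivative frechet_derivative f (at x)) (at x)"
  using Ck_on_has_derivative[of 0 S f x] unfolding smooth_on_def by blast

lemma cinv_cmap: "smooth_atlas A \<Longrightarrow> c \<in> A \<Longrightarrow> p \<in> cdom c \<Longrightarrow> cinv c (cmap c p) = p"
  by (simp add: smooth_atlas_def cinv_def inv_into_f_f)

lemma smooth_atlas_open_overlap:
  "smooth_atlas A \<Longrightarrow> c \<in> A \<Longrightarrow> d \<in> A \<Longrightarrow> open (cmap c ` (cdom c \<inter> cdom d))"
  by (simp add: smooth_atlas_def)

lemma smooth_atlas_open_image: "smooth_atlas A \<Longrightarrow> c \<in> A \<Longrightarrow> open (cmap c ` cdom c)"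
  using smooth_atlas_open_overlap[of A c c] by simp

lemma jac_has_derivative:
  assumes "smooth_atlas A" "c \<in> A" "d \<in> A" "p \<in> cdom c" "p \<in> cdom d"
  shows "((cmap d \<circ> cinv c) has_derivative jac c d p) (at (cmap c p))"
  unfolding jac_def
  by (rule smooth_on_has_derivative[where S = "cmap c ` (cdom c \<inter> cdom d)"])
    (use assms in \<open>auto simp: smooth_atlas_def\<close>)

lemma linear_jac:
  assumes "smooth_atlas A" "c \<in> A" "d \<in> A" "p \<in> cdom c" "p \<in> cdom d"
  shows "linear (jac c d p)"
  by (rule has_derivative_linear[OF jac_has_derivative[OF assms]])

text \<open>The cocycle rule. The direct change from \<open>c\<close> to \<open>e\<close> and the
  composite through \<open>d\<close> agree on the open image of the overlap of \<open>c\<close> and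
  \<open>d\<close>, which suffices to compare derivatives.\<close>

lemma jac_trans:
  assumes A: "smooth_atlas A" and cde: "c \<in> A" "d \<in> A" "e \<in> A"
    and p: "p \<in> cdom c" "p \<in> cdom d" "p \<in> cdom e"
  shows "jac c e p a = jac d e p (jac c d p a)"
proof -
  let ?W = "cmap c ` (cdom c \<inter> cdom d)"
  have eq: "(cmap d \<circ> cinv c) (cmap c p) = cmap d p"
    by (simp add: cinv_cmap[OF A cde(1) p(1)])
  have "((\<lambda>x. (cmap e \<circ> cinv d) ((cmap d \<circ> cinv c) x)) has_derivative
      (\<lambda>h. jac d e p (jac c d p h))) (at (cmap c p))"
    by (rule has_derivative_compose[OF jac_has_derivative[OF A cde(1,2) p(1,2)]])
      (use jac_has_derivative[OF A cde(2,3) p(2,3)] in \<open>simp only: eq\<close>)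
  then have "((cmap e \<circ> cinv c) has_derivative (\<lambda>h. jac d e p (jac c d p h))) (at (cmap c p))"
    by (rule has_derivative_transform_within_open[where s = ?W])
      (use A cde p in \<open>auto simp: smooth_atlas_open_overlap cinv_cmap\<close>)
  from frechet_derivative_at[OF this] show ?thesis
    unfolding jac_def by metis
qed

lemma jac_same:
  assumes "smooth_atlas A" "c \<in> A" "p \<in> cdom c"
  shows "jac c c p a = a"
proof -
  have "((cmap c \<circ> cinv c) has_derivative (\<lambda>h. h)) (at (cmap c p))"
    by (rule has_derivative_transform_within_open[OF has_derivative_ident, where s = "cmap c ` cdom c"])
      (use assms in \<open>auto simp: smooth_atlas_open_image cinv_cmap\<close>)
  from frechet_derivative_at[OF this] show ?thesis
    unfolding jac_def by metis
qed

lemma tangent_spaceD: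
  assumes "v \<in> tangent_space A p"
  shows "fst v = p" "p \<in> points A"
    "c \<in> A \<Longrightarrow> d \<in> A \<Longrightarrow> p \<in> cdom c \<Longrightarrow> p \<in> cdom d \<Longrightarrow> snd v d = jac c d p (snd v c)"
    "\<not> (c \<in> A \<and> p \<in> cdom c) \<Longrightarrow> snd v c = 0"
  using assms unfolding tangent_space_def jac_def by blast+

lemma tangent_spaceI:
  assumes "fst v = p" "p \<in> points A"
    "\<And>c d. c \<in> A \<Longrightarrow> d \<in> A \<Longrightarrow> p \<in> cdom c \<Longrightarrow> p \<in> cdom d \<Longrightarrow> snd v d = jac c d p (snd v c)"
    "\<And>c. \<not> (c \<in> A \<and> p \<in> cdom c) \<Longrightarrow> snd v c = 0"
  shows "v \<in> tangent_space A p"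
  using assms unfolding tangent_space_def jac_def by blast

lemma tangent_bundle_iff: "v \<in> tangent_bundle A \<longleftrightarrow> v \<in> tangent_space A (fst v)"
  by (auto simp: tangent_bundle_def tangent_space_def)

lemma tv_of_in_tangent_space:
  assumes "smooth_atlas A" "c \<in> A" "p \<in> cdom c"
  shows "tv_of A c p a \<in> tangent_space A p"
  using assms by (intro tangent_spaceI) (auto simp: tv_of_def points_def intro: jac_trans)

lemma tv_of_snd:
  assumes "v \<in> tangent_space A p" "c \<in> A" "p \<in> cdom c"
  shows "tv_of A c p (snd v c) = v"
proof (rule prod_eqI)
  show "snd (tv_of A c p (snd v c)) = snd v"
  proof
    fix d
    show "snd (tv_of A c p (snd v c)) d = snd v d"
      using tangent_spaceD(3)[OF assms(1,2) _ assms(3), of d] tangent_spaceD(4)[OF assms(1), of d]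
      unfolding tv_of_def snd_conv by metis
  qed
qed (use tangent_spaceD(1)[OF assms(1)] in \<open>simp add: tv_of_def\<close>)

lemma snd_tv_of:
  assumes "smooth_atlas A" "c \<in> A" "p \<in> cdom c"
  shows "snd (tv_of A c p a) c = a"
  using assms by (simp add: tv_of_def jac_same)

lemma tangent_space_eqI:
  assumes "v \<in> tangent_space A p" "w \<in> tangent_space A p"
    "\<And>c. c \<in> A \<Longrightarrow> p \<in> cdom c \<Longrightarrow> snd v c = snd w c"
  shows "v = w"
proof (rule prod_eqI)
  show "snd v = snd w"
    using tangent_spaceD(4)[OF assms(1)] tangent_spaceD(4)[OF assms(2)] assms(3) by (metis ext)
qed (use tangent_spaceD(1)[OF assms(1)] tangent_spaceD(1)[OF assms(2)] in simp)

lemma tv_zero_in_tangent_space: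
  assumes "smooth_atlas A" "p \<in> points A"
  shows "tv_zero p \<in> tangent_space A p"
  using assms by (intro tangent_spaceI) (auto simp: tv_zero_def linear_0[OF linear_jac])

lemma tv_diff_in_tangent_space:
  assumes "smooth_atlas A" "v \<in> tangent_space A p" "w \<in> tangent_space A p"
  shows "tv_diff v w \<in> tangent_space A p"
proof (rule tangent_spaceI)
  fix c d assume cd: "c \<in> A" "d \<in> A" "p \<in> cdom c" "p \<in> cdom d"
  show "snd (tv_diff v w) d = jac c d p (snd (tv_diff v w) c)"
    using tangent_spaceD(3)[OF assms(2) cd] tangent_spaceD(3)[OF assms(3) cd]
    by (simp add: tv_diff_def linear_diff[OF linear_jac[OF assms(1) cd]])
qed (use tangent_spaceD(1,2,4)[OF assms(2)] tangent_spaceD(1,2,4)[OF assms(3)] in \<open>auto simp: tv_diff_def\<close>)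

text \<open>All coordinates of the image are computed from one chart \<open>c\<close> of the source,
  so only changes of the target chart have to be compared, and these are governed by the chain
  rule.\<close>

lemma tangent_map_in_tangent_space:
  assumes A: "smooth_atlas A" and N: "smooth_atlas N" and f: "smooth_map A N f"
    and u: "u \<in> tangent_space A p"
  shows "tangent_map A N f u \<in> tangent_space N (f p)"
proof -
  define c where "c = (SOME c. c \<in> A \<and> p \<in> cdom c)"
  have "\<exists>c. c \<in> A \<and> p \<in> cdom c"
    using tangent_spaceD(2)[OF u] unfolding points_def by blast
  from someI_ex[OF this] have c: "c \<in> A" "p \<in> cdom c"
    unfolding c_def by blast+
  have eq: "tangent_map A N f u = (f p, \<lambda>d. if d \<in> N \<and> f p \<in> cdom d
      then frechet_derivative (cmap d \<circ> f \<circ> cinv c) (at (cmap c p)) (snd u c) else 0)"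
    unfolding tangent_map_def Let_def tangent_spaceD(1)[OF u] c_def ..
  have D: "((cmap d \<circ> f \<circ> cinv c) has_derivative
      frechet_derivative (cmap d \<circ> f \<circ> cinv c) (at (cmap c p))) (at (cmap c p))"
    if "d \<in> N" "f p \<in> cdom d" for d
    by (rule smooth_on_has_derivative[where S = "cmap c ` (cdom c \<inter> f -` cdom d)"])
      (use that c f in \<open>auto simp: smooth_map_def\<close>)
  show ?thesis
  proof (rule tangent_spaceI)
    show "f p \<in> points N"
      using f tangent_spaceD(2)[OF u] by (auto simp: smooth_map_def)
  next
    fix d e assume de: "d \<in> N" "e \<in> N" "f p \<in> cdom d" "f p \<in> cdom e"
    let ?W = "cmap c ` (cdom c \<inter> f -` cdom d)"
    have q: "(cmap d \<circ> f \<circ> cinv c) (cmap c p) = cmap d (f p)"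
      by (simp add: cinv_cmap[OF A c])
    have "((\<lambda>x. (cmap e \<circ> cinv d) ((cmap d \<circ> f \<circ> cinv c) x)) has_derivative
      (\<lambda>h. jac d e (f p) (frechet_derivative (cmap d \<circ> f \<circ> cinv c) (at (cmap c p)) h))) (at (cmap c p))"
      by (rule has_derivative_compose[OF D[OF de(1,3)]])
        (use jac_has_derivative[OF N de] in \<open>simp only: q\<close>)
    then have "((cmap e \<circ> f \<circ> cinv c) has_derivative
      (\<lambda>h. jac d e (f p) (frechet_derivative (cmap d \<circ> f \<circ> cinv c) (at (cmap c p)) h))) (at (cmap c p))"
      by (rule has_derivative_transform_within_open[where s = ?W])
        (use A N c de f in \<open>auto simp: smooth_map_def cinv_cmap\<close>)
    from frechet_derivative_at[OF this]
    have "frechet_derivative (cmap e \<circ> f \<circ> cinv c) (at (cmap c p)) (snd u c) =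
      jac d e (f p) (frechet_derivative (cmap d \<circ> f \<circ> cinv c) (at (cmap c p)) (snd u c))"
      by metis
    then show "snd (tangent_map A N f u) e = jac d e (f p) (snd (tangent_map A N f u) d)"
      using de by (simp add: eq)
  qed (auto simp: eq)
qed

section \<open>The atlas of the tangent bundle\<close>

lemma cdom_tangent_chart: "cdom (tangent_chart M c) = {v \<in> tangent_bundle M. fst v \<in> cdom c}"
  by (simp add: tangent_chart_def)

lemma cmap_tangent_chart: "cmap (tangent_chart M c) v = (cmap c (fst v), snd v c)"
  by (simp add: tangent_chart_def)

lemma points_tangent_atlas: "points (tangent_atlas M) = tangent_bundle M"
proof -
  have "\<exists>c\<in>M. fst v \<in> cdom c" if "v \<in> tangent_bundle M" for v
    using that tangent_spaceD(2) by (fastforce simp: tangent_bundle_iff points_def)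
  then show ?thesis
    by (auto simp: points_def tangent_atlas_def cdom_tangent_chart)
qed

lemma inj_on_tangent_chart:
  assumes "smooth_atlas M" "c \<in> M"
  shows "inj_on (cmap (tangent_chart M c)) (cdom (tangent_chart M c))"
proof (rule inj_onI)
  fix v w assume vw: "v \<in> cdom (tangent_chart M c)" "w \<in> cdom (tangent_chart M c)"
    "cmap (tangent_chart M c) v = cmap (tangent_chart M c) w"
  then have "cinv c (cmap c (fst v)) = cinv c (cmap c (fst w))" and s: "snd v c = snd w c"
    by (auto simp: cmap_tangent_chart)
  then have eq: "fst v = fst w"
    using assms vw by (simp add: cinv_cmap cdom_tangent_chart)
  have "v \<in> tangent_space M (fst v)" "w \<in> tangent_space M (fst v)" "fst v \<in> cdom c"
    using vw(1,2) by (simp_all add: cdom_tangent_chart tangent_bundle_iff eq)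
  then show "v = w"
    using tv_of_snd[OF _ assms(2)] s by metis
qed

lemma cinv_tangent_chart:
  assumes "smooth_atlas M" "c \<in> M" "p \<in> cdom c"
  shows "cinv (tangent_chart M c) (cmap c p, y) = tv_of M c p y"
proof -
  have T: "tv_of M c p y \<in> cdom (tangent_chart M c)"
    using tv_of_in_tangent_space[OF assms] assms
    by (auto simp: cdom_tangent_chart tangent_bundle_iff tv_of_def)
  have "cmap (tangent_chart M c) (tv_of M c p y) = (cmap c p, y)"
    using snd_tv_of[OF assms] by (simp add: cmap_tangent_chart) (simp add: tv_of_def)
  with inv_into_f_f[OF inj_on_tangent_chart[OF assms(1,2)] T] show ?thesis
    by (simp add: cinv_def)
qed

lemma tangent_chart_overlap:
  assumes "smooth_atlas M" "c \<in> M" "d \<in> M"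
  shows "cmap (tangent_chart M c) ` (cdom (tangent_chart M c) \<inter> cdom (tangent_chart M d)) =
    (cmap c ` (cdom c \<inter> cdom d)) \<times> UNIV"
proof (intro subset_antisym subsetI)
  fix z assume "z \<in> (cmap c ` (cdom c \<inter> cdom d)) \<times> (UNIV :: 'b set)"
  then obtain p y where p: "z = (cmap c p, y)" "p \<in> cdom c" "p \<in> cdom d"
    by auto
  have "z = cmap (tangent_chart M c) (tv_of M c p y)"
    using snd_tv_of[OF assms(1,2) p(2)] p(1)
    by (simp add: cmap_tangent_chart) (simp add: tv_of_def)
  moreover have "tv_of M c p y \<in> cdom (tangent_chart M c) \<inter> cdom (tangent_chart M d)"
    using tv_of_in_tangent_space[OF assms(1,2) p(2)] p
    by (auto simp: cdom_tangent_chart tangent_bundle_iff tv_of_def)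
  ultimately show "z \<in> cmap (tangent_chart M c) ` (cdom (tangent_chart M c) \<inter> cdom (tangent_chart M d))"
    by blast
qed (auto simp: cdom_tangent_chart cmap_tangent_chart)

lemma tangent_chart_transition:
  assumes "smooth_atlas M" "c \<in> M" "d \<in> M" "x \<in> cmap c ` (cdom c \<inter> cdom d)"
  shows "(cmap (tangent_chart M d) \<circ> cinv (tangent_chart M c)) (x, y) =
    ((cmap d \<circ> cinv c) x, frechet_derivative (cmap d \<circ> cinv c) (at x) y)"
proof -
  obtain p where p: "x = cmap c p" "p \<in> cdom c" "p \<in> cdom d" using assms(4) by auto
  show ?thesis
    using p assms cinv_tangent_chart[OF assms(1,2) p(2)]
    by (simp add: cmap_tangent_chart cinv_cmap) (simp add: tv_of_def jac_def)
qed

text \<open>A transition map sends \<open>(x, y)\<close> to the value at \<open>x\<close> of a base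
  transition and to its derivative at \<open>x\<close> applied to \<open>y\<close>. The frame
  expansion of \<open>y\<close> turns the second entry into a sum of linear coordinates of
  \<open>y\<close> times derivatives in fixed directions. One order of differentiability is lost,
  which smoothness of the base transition covers.\<close>

lemma smooth_atlas_tangent_atlas:
  assumes M: "smooth_atlas (M :: ('m, 'e::real_inner) chart set)" and B: "orthogonal_frame (B :: 'e set)"
  shows "smooth_atlas (tangent_atlas M)"
proof -
  have "open (cmap C ` (cdom C \<inter> cdom D)) \<and> smooth_on (cmap C ` (cdom C \<inter> cdom D)) (cmap D \<circ> cinv C)"
    if CD: "C \<in> tangent_atlas M" "D \<in> tangent_atlas M" for C D
  proof -
    obtain c d where cd: "c \<in> M" "d \<in> M" "C = tangent_chart M c" "D = tangent_chart M d"
      using CD by (auto simp: tangent_atlas_def)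
    let ?W = "cmap c ` (cdom c \<inter> cdom d)"
    let ?\<tau> = "cmap d \<circ> cinv c"
    let ?S = "?W \<times> (UNIV :: 'e set)"
    have W: "open ?W" "open ?S"
      using smooth_atlas_open_overlap[OF M cd(1,2)] by (auto intro: open_Times)
    have \<tau>: "Ck_on n ?W ?\<tau>" for n
      using M cd by (auto simp: smooth_atlas_def smooth_on_def)
    have "Ck_on n ?S (cmap D \<circ> cinv C)" for n
    proof -
      have f: "Ck_on n ?S fst"
        using Ck_on_bounded_linear[OF W(2) bounded_linear_fst Ck_on_id[OF W(2)]] .
      have 1: "Ck_on n ?S (\<lambda>z. ?\<tau> (fst z))"
        by (rule Ck_on_compose[OF B W(2) _ f \<tau>]) auto
      have 2: "Ck_on n ?S (\<lambda>z. frechet_derivative ?\<tau> (at (fst z)) b)" for b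
        by (rule Ck_on_compose[OF B W(2) _ f, where g = "\<lambda>x. frechet_derivative ?\<tau> (at x) b" and T = ?W])
          (use \<tau>[of "Suc n"] in auto)
      have 3: "Ck_on n ?S (\<lambda>z. snd z \<bullet> b / (b \<bullet> b))" for b
        by (rule Ck_on_bounded_linear[OF W(2) _ Ck_on_id[OF W(2)], where L = "\<lambda>z. snd z \<bullet> b / (b \<bullet> b)"])
          (intro bounded_linear_compose[OF bounded_linear_divide] bounded_linear_compose[OF bounded_linear_inner_left] bounded_linear_snd)
      have 4: "Ck_on n ?S (\<lambda>z. (?\<tau> (fst z),
          \<Sum>b\<in>B. (snd z \<bullet> b / (b \<bullet> b)) *\<^sub>R frechet_derivative ?\<tau> (at (fst z)) b))"
        by (intro Ck_on_Pair Ck_on_sum Ck_on_bilinear[OF W(2) bounded_bilinear_scaleR] W 1 2 3)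
      have 5: "(?\<tau> (fst z), \<Sum>b\<in>B. (snd z \<bullet> b / (b \<bullet> b)) *\<^sub>R frechet_derivative ?\<tau> (at (fst z)) b)
          = (cmap D \<circ> cinv C) z" if z: "z \<in> ?S" for z
      proof -
        have "fst z \<in> ?W" using z by auto
        then have "linear (frechet_derivative ?\<tau> (at (fst z)))"
          by (rule has_derivative_linear[OF Ck_on_has_derivative[OF \<tau>]])
        from linear_orthogonal_frame[OF B this, of "snd z"] show ?thesis
          using tangent_chart_transition[OF M cd(1,2), of "fst z" "snd z"] z
          unfolding cd by auto
      qed
      show ?thesis by (rule Ck_on_cong[OF W(2) 5 4])
    qed
    then show ?thesis
      using tangent_chart_overlap[OF M cd(1,2)] W(2) unfolding cd by (simp add: smooth_on_def)
  qed
  then show ?thesis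
    using inj_on_tangent_chart[OF M] by (auto simp: smooth_atlas_def tangent_atlas_def)
qed

text \<open>The derivative of a tangent transition is block triangular, and both diagonal blocks
  equal the derivative of the base transition. Restricting attention to these blocks avoids the
  off-diagonal one, which contains second derivatives.\<close>

lemma jac_tangent_chart:
  assumes M: "smooth_atlas M" and T: "smooth_atlas (tangent_atlas M)"
    and cd: "c \<in> M" "d \<in> M" and v: "v \<in> tangent_bundle M" "fst v \<in> cdom c" "fst v \<in> cdom d"
  shows "fst (jac (tangent_chart M c) (tangent_chart M d) v z) = jac c d (fst v) (fst z)"
    and "snd (jac (tangent_chart M c) (tangent_chart M d) v (0, b)) = jac c d (fst v) b"
proof -
  let ?C = "tangent_chart M c" and ?D = "tangent_chart M d"
  let ?W = "cmap c ` (cdom c \<inter> cdom d)"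
  let ?x = "cmap c (fst v)" and ?y = "snd v c"
  have W: "open ?W" "?x \<in> ?W"
    using smooth_atlas_open_overlap[OF M cd] v by auto
  have J: "((cmap ?D \<circ> cinv ?C) has_derivative jac ?C ?D v) (at (?x, ?y))"
    using jac_has_derivative[OF T, of ?C ?D v] cd v
    by (simp add: tangent_atlas_def cdom_tangent_chart cmap_tangent_chart)
  have "((\<lambda>z. fst ((cmap ?D \<circ> cinv ?C) z)) has_derivative (\<lambda>h. fst (jac ?C ?D v h))) (at (?x, ?y))"
    by (rule has_derivative_fst[OF J])
  then have 1: "((\<lambda>z. (cmap d \<circ> cinv c) (fst z)) has_derivative (\<lambda>h. fst (jac ?C ?D v h))) (at (?x, ?y))"
    by (rule has_derivative_transform_within_open[where s = "?W \<times> UNIV"])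
      (use W tangent_chart_transition[OF M cd] in \<open>auto intro: open_Times\<close>)
  have 2: "((\<lambda>z. (cmap d \<circ> cinv c) (fst z)) has_derivative (\<lambda>h. jac c d (fst v) (fst h))) (at (?x, ?y))"
    by (rule has_derivative_compose[OF has_derivative_fst[OF has_derivative_ident]])
      (use jac_has_derivative[OF M cd v(2,3)] in \<open>simp only: fst_conv\<close>)
  show "fst (jac ?C ?D v z) = jac c d (fst v) (fst z)"
    using has_derivative_unique[OF 1 2] by metis
  \<comment> \<open>Along the fibre over \<open>?x\<close> the second entry of the transition is a
    linear map, hence its own derivative.\<close>
  have "((\<lambda>y. (?x, y)) has_derivative (\<lambda>h. (0, h))) (at ?y)"
    by (intro has_derivative_Pair has_derivative_const has_derivative_ident)
  from has_derivative_snd[OF has_derivative_compose[OF this J]]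
  have 3: "(frechet_derivative (cmap d \<circ> cinv c) (at ?x) has_derivative (\<lambda>h. snd (jac ?C ?D v (0, h)))) (at ?y)"
    using tangent_chart_transition[OF M cd W(2)] by simp
  have "bounded_linear (jac c d (fst v))"
    using jac_has_derivative[OF M cd v(2,3)] has_derivative_bounded_linear by blast
  then have 4: "(frechet_derivative (cmap d \<circ> cinv c) (at ?x) has_derivative jac c d (fst v)) (at ?y)"
    unfolding jac_def by (rule bounded_linear_imp_has_derivative)
  show "snd (jac ?C ?D v (0, b)) = jac c d (fst v) b"
    using has_derivative_unique[OF 3 4] by metis
qed

section \<open>Extension of tangent vectors to vector fields\<close>

text \<open>\<open>topology\<close> is meaningful only for a family closed under finite
  intersections and unions. For intersections this uses injectivity of the charts, since images
  commute with intersections only under injective maps.\<close>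

lemma openin_atlas_topology:
  assumes M: "smooth_atlas M"
  shows "openin (atlas_topology M) W \<longleftrightarrow> W \<subseteq> points M \<and> (\<forall>c\<in>M. open (cmap c ` (cdom c \<inter> W)))"
proof -
  have int: "cmap c ` (cdom c \<inter> (S \<inter> T)) = cmap c ` (cdom c \<inter> S) \<inter> cmap c ` (cdom c \<inter> T)"
    if "c \<in> M" for c S T
  proof -
    have "inj_on (cmap c) (cdom c)" using M that by (simp add: smooth_atlas_def)
    then have "cmap c ` ((cdom c \<inter> S) \<inter> (cdom c \<inter> T)) = cmap c ` (cdom c \<inter> S) \<inter> cmap c ` (cdom c \<inter> T)"
      by (rule inj_on_image_Int) auto
    then show ?thesis by (simp add: Int_ac)
  qed
  have un: "cmap c ` (cdom c \<inter> \<Union>\<K>) = (\<Union>S\<in>\<K>. cmap c ` (cdom c \<inter> S))" for c and \<K> :: "'a set set"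
    by blast
  have "istopology (\<lambda>W. W \<subseteq> points M \<and> (\<forall>c\<in>M. open (cmap c ` (cdom c \<inter> W))))"
    unfolding istopology_def
  proof (intro conjI allI impI)
    fix \<K> :: "'a set set"
    assume "\<forall>K\<in>\<K>. K \<subseteq> points M \<and> (\<forall>c\<in>M. open (cmap c ` (cdom c \<inter> K)))"
    then show "\<Union>\<K> \<subseteq> points M" and "\<forall>c\<in>M. open (cmap c ` (cdom c \<inter> \<Union>\<K>))"
      unfolding un by blast+
  qed (use int in \<open>auto simp: open_Int\<close>)
  then show ?thesis
    by (simp add: atlas_topology_def topology_inverse')
qed

lemma topspace_atlas_topology:
  assumes M: "smooth_atlas M"
  shows "topspace (atlas_topology M) = points M"
proof -
  have "cdom c \<inter> points M = cdom c" if "c \<in> M" for c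
    using that by (auto simp: points_def)
  then have "openin (atlas_topology M) (points M)"
    by (simp add: openin_atlas_topology[OF M] smooth_atlas_open_image[OF M])
  then show ?thesis
    by (metis openin_atlas_topology[OF M] openin_subset openin_topspace subset_antisym)
qed

lemma compactin_cinv_image:
  assumes M: "smooth_atlas M" and c: "c \<in> M" and K: "compact K" "K \<subseteq> cmap c ` cdom c"
  shows "compactin (atlas_topology M) (cinv c ` K)"
proof (rule image_compactin)
  show "compactin (top_of_set K) K" using K by (simp add: compactin_subtopology)
  show "continuous_map (top_of_set K) (atlas_topology M) (cinv c)"
    unfolding continuous_map_def
  proof (intro conjI allI impI funcsetI)
    fix x assume "x \<in> topspace (top_of_set K)"
    then obtain p where "x = cmap c p" "p \<in> cdom c" using K by auto
    then show "cinv c x \<in> topspace (atlas_topology M)"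
      using c by (auto simp: topspace_atlas_topology[OF M] points_def cinv_cmap[OF M c])
  next
    fix W assume "openin (atlas_topology M) W"
    then have W: "open (cmap c ` (cdom c \<inter> W))"
      using c by (simp add: openin_atlas_topology[OF M])
    have "{x \<in> topspace (top_of_set K). cinv c x \<in> W} = K \<inter> cmap c ` (cdom c \<inter> W)"
      using K cinv_cmap[OF M c] by fastforce
    then show "openin (top_of_set K) {x \<in> topspace (top_of_set K). cinv c x \<in> W}"
      using W openin_open_Int by metis
  qed
qed

lemma vector_field_iff:
  "vector_field M X \<longleftrightarrow> smooth_map M (tangent_atlas M) X \<and> (\<forall>p\<in>points M. fst (X p) = p)"
proof -
  have "(cdom c \<inter> points M, cmap c) = c" if "c \<in> M" for c
    using that by (intro prod_eqI) (auto simp: points_def)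
  then have "restrict_atlas M (points M) = M" by (simp add: restrict_atlas_def)
  then show ?thesis by (simp add: vector_field_def vector_field_on_def)
qed

lemma vector_field_extension:
  fixes M :: "('m, 'e::real_inner) chart set"
  assumes mf: "smooth_manifold M" and v: "v \<in> tangent_bundle M"
  shows "\<exists>V. vector_field M V \<and> V (fst v) = v"
proof -
  have M: "smooth_atlas M" and haus: "Hausdorff_space (atlas_topology M)"
    using mf by (auto simp: smooth_manifold_def)
  obtain B :: "'e set" where B: "orthogonal_frame B"
    using mf orthogonal_frame_exists by (auto simp: smooth_manifold_def)
  have v': "v \<in> tangent_space M (fst v)" using v by (simp add: tangent_bundle_iff)
  obtain c\<^sub>0 where c\<^sub>0: "c\<^sub>0 \<in> M" "fst v \<in> cdom c\<^sub>0"
    using tangent_spaceD(2)[OF v'] unfolding points_def by blast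
  define y where "y = cmap c\<^sub>0 (fst v)"
  have "open (cmap c\<^sub>0 ` cdom c\<^sub>0)" "y \<in> cmap c\<^sub>0 ` cdom c\<^sub>0"
    using smooth_atlas_open_image[OF M c\<^sub>0(1)] c\<^sub>0 by (auto simp: y_def)
  then obtain r where r: "r > 0" "cball y r \<subseteq> cmap c\<^sub>0 ` cdom c\<^sub>0"
    using open_contains_cball by blast
  obtain \<beta> :: "'e \<Rightarrow> real"
    where \<beta>: "\<beta> y = 1" "\<And>x. x \<notin> cball y r \<Longrightarrow> \<beta> x = 0" "\<And>n. Ck_on n UNIV \<beta>"
    using smooth_bump_exists[OF r(1), of y] by metis
  \<comment> \<open>\<open>K\<close> contains the support of the bump. It is compact, hence closed
    in a Hausdorff space, so its complement is an open set on which the field vanishes.\<close>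
  define K where "K = cinv c\<^sub>0 ` cball y r"
  have "closedin (atlas_topology M) K"
    unfolding K_def
    by (intro compactin_imp_closedin haus compactin_cinv_image M c\<^sub>0 compact_cball_frame[OF B] r)
  then have Kop: "open (cmap c ` (cdom c \<inter> (points M - K)))" if "c \<in> M" for c
    using that by (auto simp: closedin_def openin_atlas_topology[OF M] topspace_atlas_topology[OF M])
  have K0: "\<beta> (cmap c\<^sub>0 q) = 0" if "q \<in> cdom c\<^sub>0" "q \<notin> K" for q
    using that \<beta>(2) cinv_cmap[OF M c\<^sub>0(1)] unfolding K_def by (metis imageI)
  have KD: "K \<subseteq> cdom c\<^sub>0"
    using r(2) cinv_cmap[OF M c\<^sub>0(1)] unfolding K_def by fastforce
  define a where "a = snd v c\<^sub>0"
  define X where "X q = (if q \<in> cdom c\<^sub>0 then tv_of M c\<^sub>0 q (\<beta> (cmap c\<^sub>0 q) *\<^sub>R a) else tv_zero q)" for q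
  have fstX: "fst (X q) = q" for q
    by (simp add: X_def tv_of_def tv_zero_def)
  have X_in: "X q \<in> tangent_bundle M" if "q \<in> points M" for q
    using that tv_of_in_tangent_space[OF M c\<^sub>0(1)] tv_zero_in_tangent_space[OF M]
    by (simp add: tangent_bundle_iff fstX) (simp add: X_def)
  have X_off: "snd (X q) d = 0" if "q \<notin> K" "d \<in> M" for q d
    using that K0 linear_0[OF linear_jac[OF M c\<^sub>0(1)]]
    by (auto simp: X_def tv_of_def tv_zero_def)
  have X_on: "snd (X q) d = \<beta> (cmap c\<^sub>0 q) *\<^sub>R jac c\<^sub>0 d q a"
    if "q \<in> cdom c\<^sub>0" "q \<in> cdom d" "d \<in> M" for q d
    using that linear_cmul[OF linear_jac[OF M c\<^sub>0(1)]]
    by (simp add: X_def tv_of_def)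
  have imint: "open (cmap c ` (cdom c \<inter> S \<inter> T))"
    if "c \<in> M" "open (cmap c ` (cdom c \<inter> S))" "open (cmap c ` (cdom c \<inter> T))" for c S T
  proof -
    have "inj_on (cmap c) (cdom c)" using M that by (simp add: smooth_atlas_def)
    then have "cmap c ` ((cdom c \<inter> S) \<inter> (cdom c \<inter> T)) = cmap c ` (cdom c \<inter> S) \<inter> cmap c ` (cdom c \<inter> T)"
      by (rule inj_on_image_Int) auto
    then show ?thesis using that(2,3) by (simp add: Int_ac open_Int)
  qed
  have "open (cmap c ` (cdom c \<inter> X -` cdom D)) \<and>
      smooth_on (cmap c ` (cdom c \<inter> X -` cdom D)) (cmap D \<circ> X \<circ> cinv c)"
    if cD: "c \<in> M" "D \<in> tangent_atlas M" for c D
  proof -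
    obtain d where d: "d \<in> M" "D = tangent_chart M d" using cD by (auto simp: tangent_atlas_def)
    let ?W = "cmap c ` (cdom c \<inter> cdom d)"
    have W: "open ?W" by (rule smooth_atlas_open_overlap[OF M cD(1) d(1)])
    have set: "cdom c \<inter> X -` cdom D = cdom c \<inter> cdom d"
      using X_in cD(1) by (auto simp: d(2) cdom_tangent_chart fstX points_def)
    have "Ck_on n ?W (cmap D \<circ> X \<circ> cinv c)" for n
    proof -
      have "Ck_on n ?W (\<lambda>x. snd (X (cinv c x)) d)"
      proof (rule Ck_on_local)
        fix x assume "x \<in> ?W"
        then obtain q where q: "x = cmap c q" "q \<in> cdom c" "q \<in> cdom d" by auto
        \<comment> \<open>The domain of \<open>c\<^sub>0\<close> and the complement of
          \<open>K\<close> cover the manifold. On the former the explicit formula for the field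
          applies, on the latter the field is zero.\<close>
        show "\<exists>T. open T \<and> x \<in> T \<and> Ck_on n T (\<lambda>x. snd (X (cinv c x)) d)"
        proof (cases "q \<in> cdom c\<^sub>0")
          case True
          let ?T = "cmap c ` (cdom c \<inter> cdom d \<inter> cdom c\<^sub>0)"
          let ?\<sigma> = "cmap c\<^sub>0 \<circ> cinv c" and ?\<rho> = "cmap d \<circ> cinv c\<^sub>0"
          have T: "open ?T"
            by (intro imint cD smooth_atlas_open_overlap[OF M] d c\<^sub>0)
          have \<sigma>: "Ck_on n ?T ?\<sigma>"
            by (rule Ck_on_subset[of _ "cmap c ` (cdom c \<inter> cdom c\<^sub>0)"])
              (use M cD(1) c\<^sub>0(1) in \<open>auto simp: smooth_atlas_def smooth_on_def\<close>)
          have "Ck_on (Suc n) (cmap c\<^sub>0 ` (cdom c\<^sub>0 \<inter> cdom d)) ?\<rho>"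
            using M d c\<^sub>0(1) unfolding smooth_atlas_def smooth_on_def by blast
          then have \<rho>: "Ck_on n (cmap c\<^sub>0 ` (cdom c\<^sub>0 \<inter> cdom d)) (\<lambda>z. frechet_derivative ?\<rho> (at z) a)"
            by simp
          have 1: "Ck_on n ?T (\<lambda>x. \<beta> (?\<sigma> x))"
            by (rule Ck_on_compose[OF B T _ \<sigma> \<beta>(3)]) simp
          have 2: "Ck_on n ?T (\<lambda>x. frechet_derivative ?\<rho> (at (?\<sigma> x)) a)"
            by (rule Ck_on_compose[OF B T _ \<sigma> \<rho>]) (use cinv_cmap[OF M cD(1)] in auto)
          \<comment> \<open>In the chart \<open>d\<close> the field is the bump times the derivative
            of \<open>?\<rho>\<close> in the fixed direction \<open>a\<close>, both evaluated along
            \<open>?\<sigma>\<close>.\<close>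
          have 3: "\<beta> (?\<sigma> x) *\<^sub>R frechet_derivative ?\<rho> (at (?\<sigma> x)) a = snd (X (cinv c x)) d"
            if x: "x \<in> ?T" for x
            using x X_on[OF _ _ d(1)] by (auto simp: cinv_cmap[OF M cD(1)] jac_def)
          have "Ck_on n ?T (\<lambda>x. snd (X (cinv c x)) d)"
            by (rule Ck_on_cong[OF T 3 Ck_on_bilinear[OF T bounded_bilinear_scaleR 1 2]])
          moreover have "x \<in> ?T" using q True by blast
          ultimately show ?thesis using T by blast
        next
          case False
          let ?T = "cmap c ` (cdom c \<inter> cdom d \<inter> (points M - K))"
          have T: "open ?T"
            by (intro imint cD smooth_atlas_open_overlap[OF M] d Kop)
          have 0: "0 = snd (X (cinv c x)) d" if x: "x \<in> ?T" for x
            using x X_off[OF _ d(1)] by (auto simp: cinv_cmap[OF M cD(1)])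
          have "Ck_on n ?T (\<lambda>x. snd (X (cinv c x)) d)"
            by (rule Ck_on_cong[OF T 0 Ck_on_const[OF T]])
          moreover have "x \<in> ?T" using q False KD d(1) by (auto simp: points_def)
          ultimately show ?thesis using T by blast
        qed
      qed
      moreover have "Ck_on n ?W (cmap d \<circ> cinv c)"
        using M d cD(1) by (auto simp: smooth_atlas_def smooth_on_def)
      ultimately have "Ck_on n ?W (\<lambda>x. ((cmap d \<circ> cinv c) x, snd (X (cinv c x)) d))"
        by (rule Ck_on_Pair[OF W, rotated])
      moreover have "cmap D \<circ> X \<circ> cinv c = (\<lambda>x. ((cmap d \<circ> cinv c) x, snd (X (cinv c x)) d))"
        by (auto simp: d(2) cmap_tangent_chart fstX)
      ultimately show ?thesis by simp
    qed
    with W show ?thesis by (simp add: set smooth_on_def)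
  qed
  then have "vector_field M X"
    using X_in fstX by (auto simp: vector_field_iff smooth_map_def points_tangent_atlas)
  moreover have "X (fst v) = v"
    using tv_of_snd[OF v' c\<^sub>0] \<beta>(1) c\<^sub>0 by (simp add: X_def a_def y_def)
  ultimately show ?thesis by blast
qed

section \<open>Connections\<close>

text \<open>Over a chart \<open>c\<close> the projection is \<open>fst\<close> followed by a change
  of base chart, so its derivative is \<open>jac c d\<close> applied to the first entry. By block
  triangularity this is the first entry with respect to the tangent chart of \<open>d\<close>, which
  removes the arbitrary choice of chart in \<open>tangent_map\<close>.\<close>

lemma dproj_eq:
  assumes M: "smooth_atlas M" and T: "smooth_atlas (tangent_atlas M)"
    and v: "v \<in> tangent_bundle M" and \<xi>: "\<xi> \<in> tangent_space (tangent_atlas M) v"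
  shows "dproj M \<xi> =
    (fst v, \<lambda>d. if d \<in> M \<and> fst v \<in> cdom d then fst (snd \<xi> (tangent_chart M d)) else 0)"
proof -
  define C where "C = (SOME C. C \<in> tangent_atlas M \<and> v \<in> cdom C)"
  have "\<exists>C. C \<in> tangent_atlas M \<and> v \<in> cdom C"
    using tangent_spaceD(2)[OF \<xi>] unfolding points_def by blast
  from someI_ex[OF this] have C: "C \<in> tangent_atlas M" "v \<in> cdom C"
    unfolding C_def by blast+
  then obtain c where c: "c \<in> M" "C = tangent_chart M c" "fst v \<in> cdom c"
    by (auto simp: tangent_atlas_def cdom_tangent_chart)
  have "frechet_derivative (cmap d \<circ> fst \<circ> cinv C) (at (cmap C v)) (snd \<xi> C) =
      fst (snd \<xi> (tangent_chart M d))"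
    if d: "d \<in> M" "fst v \<in> cdom d" for d
  proof -
    let ?W = "cmap c ` (cdom c \<inter> cdom d)"
    have W: "open ?W" by (rule smooth_atlas_open_overlap[OF M c(1) d(1)])
    have "((\<lambda>z. (cmap d \<circ> cinv c) (fst z)) has_derivative (\<lambda>h. jac c d (fst v) (fst h))) (at (cmap C v))"
      by (rule has_derivative_compose[OF has_derivative_fst[OF has_derivative_ident]])
        (use jac_has_derivative[OF M c(1) d(1) c(3) d(2)] in
          \<open>simp only: c(2) cmap_tangent_chart fst_conv\<close>)
    then have "((cmap d \<circ> fst \<circ> cinv C) has_derivative (\<lambda>h. jac c d (fst v) (fst h))) (at (cmap C v))"
    proof (rule has_derivative_transform_within_open)
      show "open (?W \<times> UNIV)" using W by (intro open_Times) auto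
      show "cmap C v \<in> ?W \<times> UNIV" using c d by (simp add: cmap_tangent_chart)
      show "(cmap d \<circ> cinv c) (fst z) = (cmap d \<circ> fst \<circ> cinv C) z" if z: "z \<in> ?W \<times> UNIV" for z
      proof -
        obtain p y where "z = (cmap c p, y)" "p \<in> cdom c" using z by auto
        then show ?thesis
          using cinv_tangent_chart[OF M c(1), of p y]
          by (simp add: c(2) cinv_cmap[OF M c(1)]) (simp add: tv_of_def)
      qed
    qed
    from frechet_derivative_at[OF this]
    have "frechet_derivative (cmap d \<circ> fst \<circ> cinv C) (at (cmap C v)) (snd \<xi> C) =
        jac c d (fst v) (fst (snd \<xi> C))" by metis
    also have "\<dots> = fst (jac (tangent_chart M c) (tangent_chart M d) v (snd \<xi> C))"
      using jac_tangent_chart(1)[OF M T c(1) d(1) v c(3) d(2)] by metis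
    also have "jac (tangent_chart M c) (tangent_chart M d) v (snd \<xi> C) = snd \<xi> (tangent_chart M d)"
      using tangent_spaceD(3)[OF \<xi>, of "tangent_chart M c" "tangent_chart M d"] c d v
      by (simp add: tangent_atlas_def cdom_tangent_chart)
    finally show ?thesis .
  qed
  then show ?thesis
    unfolding dproj_def tangent_map_def Let_def tangent_spaceD(1)[OF \<xi>] C_def[symmetric]
    by (auto intro!: ext)
qed

section \<open>Horizontal and vertical fibres\<close>

lemma fibre_iff: "w \<in> fibre E v \<longleftrightarrow> w \<in> E \<and> fst w = v"
  by (simp add: fibre_def)

lemma fibre_vertical_iff:
  assumes M: "smooth_atlas M" and T: "smooth_atlas (tangent_atlas M)" and v: "v \<in> tangent_bundle M"
  shows "w \<in> fibre (vertical M) v \<longleftrightarrow> w \<in> tangent_space (tangent_atlas M) v \<and>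
    (\<forall>c\<in>M. fst v \<in> cdom c \<longrightarrow> fst (snd w (tangent_chart M c)) = 0)"
proof -
  have "w \<in> fibre (vertical M) v \<longleftrightarrow>
      w \<in> tangent_space (tangent_atlas M) v \<and> dproj M w = tv_zero (fst v)"
    using tangent_spaceD(1)[of w "tangent_atlas M" v]
    by (auto simp: fibre_iff vertical_def tangent_bundle_iff)
  moreover have "dproj M w = tv_zero (fst v) \<longleftrightarrow>
      (\<forall>c\<in>M. fst v \<in> cdom c \<longrightarrow> fst (snd w (tangent_chart M c)) = 0)"
    if "w \<in> tangent_space (tangent_atlas M) v"
    unfolding dproj_eq[OF M T v that] tv_zero_def prod.inject fun_eq_iff by auto
  ultimately show ?thesis by blast
qed

lemma connection_fibre:
  assumes "connection M H" "h \<in> fibre H v"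
  shows "h \<in> tangent_space (tangent_atlas M) v"
  using assms by (auto simp: connection_def smooth_subbundle_def fibre_iff tangent_bundle_iff)

text \<open>A local frame presents the fibre as the set of all linear combinations of its values at
  \<open>v\<close>; subtracting coefficients subtracts vectors.\<close>

lemma connection_fibre_diff:
  assumes "connection M H" "h \<in> fibre H v" "h' \<in> fibre H v" "v \<in> tangent_bundle M"
  shows "tv_diff h h' \<in> fibre H v"
proof -
  have sb: "smooth_subbundle (tangent_atlas M) H"
    using assms(1) by (simp add: connection_def)
  have pt: "v \<in> points (tangent_atlas M)"
    using assms(4) by (simp add: points_tangent_atlas)
  from bspec[OF conjunct2[OF sb[unfolded smooth_subbundle_def]] pt]
  obtain W k X where W: "v \<in> W"
      "\<forall>q\<in>W. (\<forall>a. lincomb k a X q = tv_zero q \<longrightarrow> (\<forall>i<k. a i = 0)) \<and>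
        H \<inter> tangent_space (tangent_atlas M) q = range (\<lambda>a. lincomb k a X q)"
    by (elim exE conjE) (rule that)
  have "H \<inter> tangent_space (tangent_atlas M) v = range (\<lambda>a. lincomb k a X v)"
    by (rule conjunct2[OF bspec[OF W(2,1)]])
  moreover have "fibre H v = H \<inter> tangent_space (tangent_atlas M) v"
    using connection_fibre[OF assms(1)] tangent_spaceD(1) by (fastforce simp: fibre_iff)
  ultimately have eq: "fibre H v = range (\<lambda>a. lincomb k a X v)" by simp
  obtain a b where "h = lincomb k a X v" "h' = lincomb k b X v"
    using assms(2,3) unfolding eq by blast
  then have "tv_diff h h' = lincomb k (\<lambda>i. a i - b i) X v"
    by (simp add: tv_diff_def lincomb_def scaleR_left_diff_distrib sum_subtractf)
  then show ?thesis unfolding eq by blast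
qed

text \<open>The difference of the two vectors is horizontal, and vertical because their projections
  agree; the two fibres meet only in zero.\<close>

lemma horizontal_eqI:
  assumes M: "smooth_atlas M" and T: "smooth_atlas (tangent_atlas M)" and H: "connection M H"
    and v: "v \<in> tangent_bundle M" and h: "h \<in> fibre H v" "h' \<in> fibre H v"
    and eq: "dproj M h = dproj M h'"
  shows "h = h'"
proof -
  note hT = connection_fibre[OF H h(1)] connection_fibre[OF H h(2)]
  have "fst (snd h (tangent_chart M c)) = fst (snd h' (tangent_chart M c))"
    if "c \<in> M" "fst v \<in> cdom c" for c
    using fun_cong[OF arg_cong[OF eq, of snd], of c] that
    unfolding dproj_eq[OF M T v hT(1)] dproj_eq[OF M T v hT(2)] by simp
  then have "tv_diff h h' \<in> fibre (vertical M) v"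
    unfolding fibre_vertical_iff[OF M T v] using tv_diff_in_tangent_space[OF T hT]
    by (simp add: tv_diff_def)
  moreover have "fibre H v \<inter> fibre (vertical M) v = {tv_zero v}"
    using H v by (simp add: connection_def)
  ultimately have z: "tv_diff h h' = tv_zero v"
    using connection_fibre_diff[OF H h v] by blast
  have "snd h c = snd h' c" for c
    using fun_cong[OF arg_cong[OF z, of snd], of c] by (simp add: tv_diff_def tv_zero_def)
  then show ?thesis by (intro tangent_space_eqI[OF hT])
qed

lemma hproj:
  assumes M: "smooth_atlas M" and T: "smooth_atlas (tangent_atlas M)" and H: "connection M H"
    and v: "v \<in> tangent_bundle M" and \<xi>: "\<xi> \<in> tangent_space (tangent_atlas M) v"
  shows "hproj M H \<xi> \<in> fibre H v" and "dproj M (hproj M H \<xi>) = dproj M \<xi>"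
proof -
  \<comment> \<open>A vertical summand does not change the projection. With
    \<open>horizontal_eqI\<close> this makes the horizontal part unique, and it also yields the
    second claim.\<close>
  have D: "dproj M h = dproj M \<xi>"
    if "h \<in> fibre H v" "w \<in> fibre (vertical M) v" "\<xi> = tv_add h w" for h w
  proof -
    have "fst (snd \<xi> (tangent_chart M c)) = fst (snd h (tangent_chart M c))"
      if "c \<in> M" "fst v \<in> cdom c" for c
      using \<open>w \<in> fibre (vertical M) v\<close> that
      unfolding fibre_vertical_iff[OF M T v] \<open>\<xi> = tv_add h w\<close> by (simp add: tv_add_def)
    then show ?thesis
      unfolding dproj_eq[OF M T v \<xi>] dproj_eq[OF M T v connection_fibre[OF H that(1)]] by auto
  qed
  have "\<exists>!h. h \<in> fibre H v \<and> (\<exists>w\<in>fibre (vertical M) v. \<xi> = tv_add h w)"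
  proof (rule ex_ex1I)
    show "\<exists>h. h \<in> fibre H v \<and> (\<exists>w\<in>fibre (vertical M) v. \<xi> = tv_add h w)"
      using H v \<xi> unfolding connection_def by blast
  next
    fix h h'
    assume "h \<in> fibre H v \<and> (\<exists>w\<in>fibre (vertical M) v. \<xi> = tv_add h w)"
      and "h' \<in> fibre H v \<and> (\<exists>w\<in>fibre (vertical M) v. \<xi> = tv_add h' w)"
    then show "h = h'"
      using horizontal_eqI[OF M T H v] D by metis
  qed
  from theI'[OF this] have "hproj M H \<xi> \<in> fibre H v \<and>
      (\<exists>w\<in>fibre (vertical M) v. \<xi> = tv_add (hproj M H \<xi>) w)"
    unfolding hproj_def tangent_spaceD(1)[OF \<xi>] .
  then show "hproj M H \<xi> \<in> fibre H v" "dproj M (hproj M H \<xi>) = dproj M \<xi>"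
    using D by blast+
qed

text \<open>The horizontal part of \<open>\<xi>\<close> is a preimage of \<open>v\<close> in the
  fibre, and \<open>dproj\<close> is injective there, so \<open>inv_into\<close> must select
  it.\<close>

lemma quasispray_eq_hproj:
  assumes M: "smooth_atlas M" and T: "smooth_atlas (tangent_atlas M)" and H: "connection M H"
    and v: "v \<in> tangent_bundle M" and \<xi>: "\<xi> \<in> tangent_space (tangent_atlas M) v"
    and "dproj M \<xi> = v"
  shows "quasispray M H v = hproj M H \<xi>"
proof -
  have "inj_on (dproj M) (fibre H v)"
    using horizontal_eqI[OF M T H v] by (intro inj_onI)
  then show ?thesis
    unfolding quasispray_def using hproj[OF M T H v \<xi>] assms(6) by (intro inv_into_f_eq) auto
qed

section \<open>The vertical lift and \<open>K_map\<close> in charts\<close>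

lemma snd_vlift:
  assumes v: "v \<in> tangent_bundle M" and c: "c \<in> M" "fst v \<in> cdom c"
  shows "snd (vlift M v w) (tangent_chart M c) = (0, snd w c)"
proof -
  have "((\<lambda>t. (cmap c (fst v), snd v c + t *\<^sub>R snd w c)) has_vector_derivative (0, snd w c)) (at 0)"
    by (auto intro!: derivative_eq_intros has_vector_derivative_Pair)
  then have "vector_derivative (\<lambda>t. (cmap c (fst v), snd v c + t *\<^sub>R snd w c)) (at 0) = (0, snd w c)"
    by (rule vector_derivative_at)
  then show ?thesis
    using v c
    by (simp add: vlift_def velocity_def comp_def tv_add_def tv_scale_def cmap_tangent_chart
        cdom_tangent_chart tangent_atlas_def)
qed

text \<open>The second entries of a vertical vector transform by the lower diagonal block of
  \<open>jac_tangent_chart\<close>, so they are the coordinates of a tangent vector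
  \<open>?u\<close> on the base; its vertical lift has the entries of \<open>w\<close>.\<close>

lemma K_map_vertical:
  assumes M: "smooth_atlas M" and T: "smooth_atlas (tangent_atlas M)" and v: "v \<in> tangent_bundle M"
    and w: "w \<in> fibre (vertical M) v"
  shows "K_map M w =
    (fst v, \<lambda>c. if c \<in> M \<and> fst v \<in> cdom c then snd (snd w (tangent_chart M c)) else 0)"
    (is "_ = ?u")
proof -
  have w0: "snd w (tangent_chart M c) = (0, snd (snd w (tangent_chart M c)))"
    if "c \<in> M" "fst v \<in> cdom c" for c
    using w that unfolding fibre_vertical_iff[OF M T v] by (auto intro: prod_eqI)
  have wT: "w \<in> tangent_space (tangent_atlas M) v"
    using w unfolding fibre_vertical_iff[OF M T v] by blast
  have vT: "v \<in> tangent_space M (fst v)" using v by (simp add: tangent_bundle_iff)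
  have u: "?u \<in> tangent_space M (fst v)"
  proof (rule tangent_spaceI)
    fix c d assume cd: "c \<in> M" "d \<in> M" "fst v \<in> cdom c" "fst v \<in> cdom d"
    have "snd w (tangent_chart M d) = jac (tangent_chart M c) (tangent_chart M d) v (snd w (tangent_chart M c))"
      using tangent_spaceD(3)[OF wT, of "tangent_chart M c" "tangent_chart M d"] cd v
      by (simp add: tangent_atlas_def cdom_tangent_chart)
    also have "\<dots> = jac (tangent_chart M c) (tangent_chart M d) v (0, snd (snd w (tangent_chart M c)))"
      using w0[OF cd(1,3)] by metis
    finally have "snd (snd w (tangent_chart M d)) = jac c d (fst v) (snd (snd w (tangent_chart M c)))"
      using jac_tangent_chart(2)[OF M T cd(1,2) v cd(3,4)] by metis
    then show "snd ?u d = jac c d (fst v) (snd ?u c)" using cd by simp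
  qed (use tangent_spaceD(2)[OF vT] in auto)
  have lift: "vlift M v ?u = w"
  proof (rule prod_eqI)
    have v0: "tv_add v (tv_scale 0 x) = v" for x
      by (simp add: tv_add_def tv_scale_def)
    then show "fst (vlift M v ?u) = fst w"
      using tangent_spaceD(1)[OF wT] by (simp add: vlift_def velocity_def)
    show "snd (vlift M v ?u) = snd w"
    proof
      fix C
      show "snd (vlift M v ?u) C = snd w C"
      proof (cases "C \<in> tangent_atlas M \<and> v \<in> cdom C")
        case True
        then obtain c where c: "c \<in> M" "C = tangent_chart M c" "fst v \<in> cdom c"
          by (auto simp: tangent_atlas_def cdom_tangent_chart)
        show ?thesis
          unfolding c(2) snd_vlift[OF v c(1,3)] using w0[OF c(1,3)] c by simp
      next
        \<comment> \<open>Off the charts around \<open>v\<close> both families take the default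
          value zero; by \<open>v0\<close> the curve defining the lift passes through
          \<open>v\<close> at time zero.\<close>
        case False
        then show ?thesis
          using tangent_spaceD(4)[OF wT False] by (auto simp: vlift_def velocity_def v0)
      qed
    qed
  qed
  have fw: "fst w = v" by (rule tangent_spaceD(1)[OF wT])
  show ?thesis
    unfolding K_map_def fw
  proof (rule the_equality)
    fix x assume x: "x \<in> tangent_space M (fst v) \<and> vlift M v x = w"
    show "x = ?u"
    proof (rule tangent_space_eqI[OF _ u])
      fix c assume c: "c \<in> M" "fst v \<in> cdom c"
      have "snd (vlift M v x) (tangent_chart M c) = (0, snd x c)"
        by (rule snd_vlift[OF v c])
      then show "snd x c = snd ?u c" using x c by simp
    qed (use x in blast)
  qed (use u lift in blast)
qed

text \<open>The second claim is the derivative of the identity that \<open>fst\<close> composed with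
  \<open>V\<close> is the identity on points.\<close>

lemma tangent_map_section:
  assumes M: "smooth_atlas M" and T: "smooth_atlas (tangent_atlas M)"
    and V: "smooth_map M (tangent_atlas M) V" "\<And>p. p \<in> points M \<Longrightarrow> fst (V p) = p"
    and u: "u \<in> tangent_space M p"
  shows "tangent_map M (tangent_atlas M) V u \<in> tangent_space (tangent_atlas M) (V p)"
    and "dproj M (tangent_map M (tangent_atlas M) V u) = u"
proof -
  let ?\<xi> = "tangent_map M (tangent_atlas M) V u"
  show \<xi>: "?\<xi> \<in> tangent_space (tangent_atlas M) (V p)"
    by (rule tangent_map_in_tangent_space[OF M T V(1) u])
  have p: "p \<in> points M" by (rule tangent_spaceD(2)[OF u])
  have Vp: "V p \<in> tangent_bundle M" "fst (V p) = p"
    using V p by (auto simp: smooth_map_def points_tangent_atlas)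
  define c where "c = (SOME c. c \<in> M \<and> p \<in> cdom c)"
  have "\<exists>c. c \<in> M \<and> p \<in> cdom c"
    using p unfolding points_def by blast
  from someI_ex[OF this] have c: "c \<in> M" "p \<in> cdom c"
    unfolding c_def by blast+
  have fs: "fst (snd ?\<xi> (tangent_chart M d)) = snd u d" if d: "d \<in> M" "p \<in> cdom d" for d
  proof -
    let ?D = "tangent_chart M d"
    let ?F = "cmap ?D \<circ> V \<circ> cinv c"
    let ?S = "cmap c ` (cdom c \<inter> V -` cdom ?D)"
    have D: "?D \<in> tangent_atlas M" "V p \<in> cdom ?D"
      using d Vp by (auto simp: tangent_atlas_def cdom_tangent_chart)
    have S: "open ?S" "smooth_on ?S ?F" "cmap c p \<in> ?S"
      using V(1) c D by (auto simp: smooth_map_def)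
    have eq: "snd ?\<xi> ?D = frechet_derivative ?F (at (cmap c p)) (snd u c)"
      unfolding tangent_map_def Let_def tangent_spaceD(1)[OF u] c_def[symmetric] using D by simp
    have 1: "((\<lambda>x. fst (?F x)) has_derivative (\<lambda>h. fst (frechet_derivative ?F (at (cmap c p)) h)))
        (at (cmap c p))"
      by (rule has_derivative_fst[OF smooth_on_has_derivative[OF S(2,3)]])
    \<comment> \<open>Because \<open>V\<close> is a section, the first entry of its coordinate
      expression is the change of charts from \<open>c\<close> to \<open>d\<close>.\<close>
    have "((\<lambda>x. fst (?F x)) has_derivative jac c d p) (at (cmap c p))"
    proof (rule has_derivative_transform_within_open[OF jac_has_derivative[OF M c(1) d(1) c(2) d(2)] S(1,3)])
      fix x assume "x \<in> ?S"
      then obtain q where q: "x = cmap c q" "q \<in> cdom c" by auto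
      then have "fst (V q) = q" using V(2) c(1) unfolding points_def by blast
      then show "(cmap d \<circ> cinv c) x = fst (?F x)"
        using q by (simp add: cinv_cmap[OF M c(1)] cmap_tangent_chart)
    qed
    from has_derivative_unique[OF 1 this]
    have "fst (snd ?\<xi> ?D) = jac c d p (snd u c)" unfolding eq by metis
    then show ?thesis using tangent_spaceD(3)[OF u c(1) d(1) c(2) d(2)] by simp
  qed
  show "dproj M ?\<xi> = u"
  proof (rule prod_eqI)
    show "fst (dproj M ?\<xi>) = fst u"
      using dproj_eq[OF M T Vp(1) \<xi>] Vp(2) tangent_spaceD(1)[OF u] by simp
    show "snd (dproj M ?\<xi>) = snd u"
    proof
      fix d
      show "snd (dproj M ?\<xi>) d = snd u d"
        using dproj_eq[OF M T Vp(1) \<xi>] Vp(2) tangent_spaceD(4)[OF u, of d] fs[of d] by auto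
    qed
  qed
qed

section \<open>Covariant derivative and difference operator on the diagonal\<close>

lemma covariant_derivative_diagonal:
  assumes M: "smooth_atlas M" and T: "smooth_atlas (tangent_atlas M)" and H: "connection M H"
    and V: "vector_field M V" and v: "v \<in> tangent_bundle M" "V (fst v) = v" "U (fst v) = v"
  shows "covariant_derivative M H U V (fst v) =
    (fst v, \<lambda>c. if c \<in> M \<and> fst v \<in> cdom c
      then snd (snd (tangent_map M (tangent_atlas M) V v) (tangent_chart M c)) -
        snd (snd (quasispray M H v) (tangent_chart M c)) else 0)"
proof -
  let ?\<xi> = "tangent_map M (tangent_atlas M) V v"
  have vT: "v \<in> tangent_space M (fst v)" using v by (simp add: tangent_bundle_iff)
  have V': "smooth_map M (tangent_atlas M) V" "\<And>p. p \<in> points M \<Longrightarrow> fst (V p) = p"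
    using V by (auto simp: vector_field_iff)
  note \<xi> = tangent_map_section[OF M T V' vT, unfolded v(2)]
  note Q = quasispray_eq_hproj[OF M T H v(1) \<xi>]
  note h = hproj[OF M T H v(1) \<xi>(1)]
  note hT = connection_fibre[OF H h(1)]
  have "fst (snd ?\<xi> (tangent_chart M c)) = fst (snd (hproj M H ?\<xi>) (tangent_chart M c))"
    if "c \<in> M" "fst v \<in> cdom c" for c
    using fun_cong[OF arg_cong[OF h(2), of snd], of c] that
      dproj_eq[OF M T v(1) \<xi>(1)] dproj_eq[OF M T v(1) hT] by simp
  then have "tv_diff ?\<xi> (hproj M H ?\<xi>) \<in> fibre (vertical M) v"
    unfolding fibre_vertical_iff[OF M T v(1)] using tv_diff_in_tangent_space[OF T \<xi>(1) hT]
    by (simp add: tv_diff_def)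
  \<comment> \<open>\<open>K_map\<close> reads the second entry of the vertical part, and the
    subtracted horizontal part is the quasispray by \<open>Q\<close>.\<close>
  from K_map_vertical[OF M T v(1) this] show ?thesis
    by (simp add: covariant_derivative_def Let_def v(3) Q tv_diff_def cong: if_cong)
qed

text \<open>The second entries of the differential of \<open>V\<close> at \<open>v\<close> occur in
  both covariant derivatives and cancel, so every admissible pair of fields gives \<open>?w\<close>;
  an extension of \<open>v\<close> shows that such a pair exists.\<close>

lemma difference_at_diagonal:
  assumes mf: "smooth_manifold M" and T: "smooth_atlas (tangent_atlas M)"
    and H': "connection M H'" and H: "connection M H" and v: "v \<in> tangent_bundle M"
  shows "difference_at M H' H v v =
    (fst v, \<lambda>c. if c \<in> M \<and> fst v \<in> cdom c
      then snd (snd (quasispray M H v) (tangent_chart M c)) -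
        snd (snd (quasispray M H' v) (tangent_chart M c)) else 0)"
    (is "_ = ?w")
proof -
  have M: "smooth_atlas M" using mf by (simp add: smooth_manifold_def)
  have D: "difference_operator M H' H U V (fst v) = ?w"
    if "vector_field M V" "U (fst v) = v" "V (fst v) = v" for U V
    unfolding difference_operator_def
      covariant_derivative_diagonal[where H = H and U = U and V = V and v = v, OF M T H that(1) v that(3,2)]
      covariant_derivative_diagonal[where H = H' and U = U and V = V and v = v, OF M T H' that(1) v that(3,2)]
    by (auto simp: tv_diff_def)
  obtain V where V: "vector_field M V" "V (fst v) = v"
    using vector_field_extension[OF mf v] by blast
  show ?thesis
    unfolding difference_at_def
  proof (rule the_equality)
    show "\<exists>U V. vector_field M U \<and> vector_field M V \<and> U (fst v) = v \<and> V (fst v) = v \<and>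
        ?w = difference_operator M H' H U V (fst v)"
      \<comment> \<open>On the diagonal one extension can serve as both fields.\<close>
      using V D[of V V, OF V(1) V(2) V(2)] by (intro exI[of _ V]) simp
  next
    fix w
    assume "\<exists>U V. vector_field M U \<and> vector_field M V \<and> U (fst v) = v \<and> V (fst v) = v \<and>
        w = difference_operator M H' H U V (fst v)"
    then show "w = ?w" using D by (elim exE conjE) simp
  qed
qed

theorem theorem4p17:
  fixes M :: "('m, 'e::real_inner) chart set"
    and H' H :: "('m, 'e) ttvec set"
  assumes "smooth_manifold M"
    and "connection M H'" and "connection M H"
  shows "(\<forall>v\<in>tangent_bundle M. quasispray M H' v = quasispray M H v) \<longleftrightarrow>
         (\<forall>v\<in>tangent_bundle M. difference_at M H' H v v = tv_zero (fst v))"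
proof -
  have M: "smooth_atlas M" using assms(1) by (simp add: smooth_manifold_def)
  obtain B :: "'e set" where B: "orthogonal_frame B"
    using assms(1) orthogonal_frame_exists by (auto simp: smooth_manifold_def)
  have T: "smooth_atlas (tangent_atlas M)" by (rule smooth_atlas_tangent_atlas[OF M B])
  have "quasispray M H' v = quasispray M H v \<longleftrightarrow> difference_at M H' H v v = tv_zero (fst v)"
    if v: "v \<in> tangent_bundle M" for v
  proof
    assume "quasispray M H' v = quasispray M H v"
    then show "difference_at M H' H v v = tv_zero (fst v)"
      unfolding difference_at_diagonal[OF assms(1) T assms(2,3) v] tv_zero_def by auto
  next
    assume 0: "difference_at M H' H v v = tv_zero (fst v)"
    \<comment> \<open>The differential of an extension of \<open>v\<close>, applied to
      \<open>v\<close>, is a vector over \<open>v\<close>; the quasispray is its horizontal part and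
      therefore lies over \<open>v\<close> as well.\<close>
    have S: "quasispray M E v \<in> tangent_space (tangent_atlas M) v \<and> dproj M (quasispray M E v) = v"
      if E: "connection M E" for E
    proof -
      obtain V where V: "vector_field M V" "V (fst v) = v"
        using vector_field_extension[OF assms(1) v] by blast
      have V': "smooth_map M (tangent_atlas M) V" "\<And>p. p \<in> points M \<Longrightarrow> fst (V p) = p"
        using V by (auto simp: vector_field_iff)
      note \<xi> = tangent_map_section[OF M T V' v[unfolded tangent_bundle_iff], unfolded V(2)]
      show ?thesis
        using hproj[OF M T E v \<xi>(1)] connection_fibre[OF E] \<xi>(2)
        by (simp add: quasispray_eq_hproj[OF M T E v \<xi>])
    qed
    note S' = S[OF assms(2)] and S = S[OF assms(3)]
    show "quasispray M H' v = quasispray M H v"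
    proof (rule tangent_space_eqI)
      show "quasispray M H' v \<in> tangent_space (tangent_atlas M) v" using S' ..
      show "quasispray M H v \<in> tangent_space (tangent_atlas M) v" using S ..
      fix C assume "C \<in> tangent_atlas M" "v \<in> cdom C"
      then obtain c where c: "c \<in> M" "C = tangent_chart M c" "fst v \<in> cdom c"
        by (auto simp: tangent_atlas_def cdom_tangent_chart)
      have "snd (dproj M (quasispray M H' v)) c = snd (dproj M (quasispray M H v)) c"
        using S S' by simp
      \<comment> \<open>The first entries agree because both vectors project to \<open>v\<close>;
        the second entries agree by the vanishing of the difference operator.\<close>
      then have "fst (snd (quasispray M H' v) C) = fst (snd (quasispray M H v) C)"
        unfolding dproj_eq[OF M T v conjunct1[OF S]] dproj_eq[OF M T v conjunct1[OF S']]
        using c by simp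
      moreover have "snd (snd (quasispray M H' v) C) = snd (snd (quasispray M H v) C)"
        using fun_cong[OF arg_cong[OF 0, of snd], of c] c
        unfolding difference_at_diagonal[OF assms(1) T assms(2,3) v] tv_zero_def by simp
      ultimately show "snd (quasispray M H' v) C = snd (quasispray M H v) C"
        by (rule prod_eqI)
    qed
  qed
  then show ?thesis by simp
qed

end
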